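(* Let $d\ge 2$ be an integer and let $p,q\in[1,+\infty]$ satisfy one of the following: (i) $d=2$, $1\le p\le +\infty$ and $1\le q<+\infty$; (ii) $d=2$, $p=1$ and $q=+\infty$; (iii) $d\ge 3$, $1\le p\le+\infty$ and $1\le q\le+\infty$. Then $(\mathcal{P}_p(\mathbb{R}^d), SW_{p,q})$ and $(\mathcal{P}_p(\mathbb{R}^d), W_p)$ are not bi-Lipschitz equivalent.
   Context: For $1\le p<+\infty$, $\mathcal{P}_p(\mathbb{R}^d)$ is the set of Borel probability measures on $\mathbb{R}^d$ with finite $p$-th moment; $\mathcal{P}_\infty(\mathbb{R}^d)$ is the set of Borel probability measures with bounded support. $W_p$ denotes the $p$-Wasserstein distance with respect to the Euclidean distance (on $\mathbb{R}^d$, or on $\mathbb{R}$ for one-dimensional measures); $W_\infty(\mu,\nu)$ is the infimum over couplings $\gamma$ of $\mu,\nu$ of the $\gamma$-essential supremum of $|x-y|$. For $\theta\in\mathbb{S}^{d-1}$ let $R^\theta:\mathbb{R}^d\to\mathbb{R}$, $R^\theta(x)=x\cdot\theta$, and let $f_\sharp\mu$ be the push-forward of $\mu$ by $f$. For $\mu,\nu\in\mathcal{P}_p(\mathbb{R}^d)$ the $p,q$ sliced Wasserstein metric is $$SW_{p,q}(\mu,\nu)=\left[\frac{1}{\mathcal{H}^{d-1}(\mathbb{S}^{d-1})}\int_{\mathbb{S}^{d-1}}\big(W_p(R^\theta_\sharp\mu,R^\theta_\sharp\nu)\big)^q\,d\mathcal{H}^{d-1}(\theta)\right]^{1/q},$$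 where for $q=+\infty$ this is understood as $\sup_{\theta\in\mathbb{S}^{d-1}}W_p(R^\theta_\sharp\mu,R^\theta_\sharp\nu)$, and $\mathcal{H}^{k}$ is $k$-dimensional Hausdorff measure. Two metrics $\rho_1,\rho_2$ on the same set $X$ are bi-Lipschitz equivalent if there is a constant $C\ge1$ with $C^{-1}\rho_1(\mu,\nu)\le\rho_2(\mu,\nu)\le C\rho_1(\mu,\nu)$ for all $\mu,\nu\in X$. *)

theory Defs
  imports "HOL-Probability.Probability"
begin

section \<open>Hausdorff measure\<close>

text \<open>
  The normalisation \<open>\<omega>\<^sub>k (diam U / 2)\<^sup>k\<close> makes the \<open>k\<close>-dimensional Hausdorff measure agree with
  Lebesgue measure on \<open>k\<close>-dimensional Euclidean space. The empty set is treated separately because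
  \<open>0 ^ 0 = 1\<close>.
\<close>

definition hausdorff_gauge :: "nat \<Rightarrow> 'a::metric_space set \<Rightarrow> ennreal" where
  "hausdorff_gauge k U =
    (if U = {} then 0 else ennreal (unit_ball_vol (real k) * (diameter U / 2) ^ k))"

text \<open>\<^const>\<open>diameter\<close> is only meaningful on bounded sets, hence the boundedness condition.\<close>

definition hausdorff_pre :: "nat \<Rightarrow> real \<Rightarrow> 'a::metric_space set \<Rightarrow> ennreal" where
  "hausdorff_pre k \<delta> A =
    (INF U \<in> {U :: nat \<Rightarrow> 'a set. A \<subseteq> (\<Union>i. U i) \<and> (\<forall>i. bounded (U i) \<and> diameter (U i) \<le> \<delta>)}.
      \<Sum>i. hausdorff_gauge k (U i))"

definition hausdorff_outer :: "nat \<Rightarrow> 'a::metric_space set \<Rightarrow> ennreal" where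
  "hausdorff_outer k A = (SUP \<delta> \<in> {0<..}. hausdorff_pre k \<delta> A)"

definition hausdorff_measure :: "nat \<Rightarrow> 'a::metric_space measure" where
  "hausdorff_measure k = measure_of UNIV (sets borel) (hausdorff_outer k)"

subsection \<open>The Hausdorff outer measure is a measure on the Borel sets\<close>

lemma hausdorff_pre_empty: "\<delta> > 0 \<Longrightarrow> hausdorff_pre k \<delta> {} = 0"
  unfolding hausdorff_pre_def
  by (rule antisym, rule INF_lower2[of "\<lambda>_. {}"]) (auto simp: hausdorff_gauge_def diameter_def)

lemma hausdorff_pre_mono: "A \<subseteq> B \<Longrightarrow> hausdorff_pre k \<delta> A \<le> hausdorff_pre k \<delta> B"
  unfolding hausdorff_pre_def by (rule INF_superset_mono) auto

lemma hausdorff_pre_antimono: "\<delta> \<le> \<delta>' \<Longrightarrow> hausdorff_pre k \<delta>' A \<le> hausdorff_pre k \<delta> A"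
  unfolding hausdorff_pre_def by (rule INF_superset_mono) (auto intro: order_trans)

lemma hausdorff_pre_subadditive:
  fixes A :: "nat \<Rightarrow> 'a::metric_space set"
  shows "hausdorff_pre k \<delta> (\<Union>i. A i) \<le> (\<Sum>i. hausdorff_pre k \<delta> (A i))"
proof (rule ennreal_le_epsilon)
  fix e :: real
  assume e: "0 < e" and fin: "(\<Sum>i. hausdorff_pre k \<delta> (A i)) < top"
  have "\<exists>U. A i \<subseteq> (\<Union>j. U j) \<and> (\<forall>j. bounded (U j) \<and> diameter (U j) \<le> \<delta>) \<and>
      (\<Sum>j. hausdorff_gauge k (U j)) \<le> hausdorff_pre k \<delta> (A i) + ennreal (e * (1/2) ^ Suc i)" for i
  proof -
    have "hausdorff_pre k \<delta> (A i) \<noteq> top"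
      using ennreal_suminf_lessD[OF fin, of i] by simp
    then have "hausdorff_pre k \<delta> (A i) < hausdorff_pre k \<delta> (A i) + ennreal (e * (1/2) ^ Suc i)"
      using e by (auto simp: ennreal_add_left_cancel_less less_top)
    then show ?thesis
      unfolding hausdorff_pre_def[of _ _ "A i"] INF_less_iff by (auto intro: less_imp_le)
  qed
  then obtain U where U: "\<And>i. A i \<subseteq> (\<Union>j. U i j)" "\<And>i j. bounded (U i j)"
      "\<And>i j. diameter (U i j) \<le> \<delta>"
      "\<And>i. (\<Sum>j. hausdorff_gauge k (U i j)) \<le> hausdorff_pre k \<delta> (A i) + ennreal (e * (1/2) ^ Suc i)"
    by metis
  define V where "V = (\<lambda>n. case prod_decode n of (i, j) \<Rightarrow> U i j)"
  have "(\<Union>i. A i) \<subseteq> (\<Union>n. V n)"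
  proof
    fix x assume "x \<in> (\<Union>i. A i)"
    then obtain i j where "x \<in> U i j" using U(1) by blast
    then have "x \<in> V (prod_encode (i, j))" by (simp add: V_def)
    then show "x \<in> (\<Union>n. V n)" by blast
  qed
  then have "hausdorff_pre k \<delta> (\<Union>i. A i) \<le> (\<Sum>n. hausdorff_gauge k (V n))"
    unfolding hausdorff_pre_def
    by (intro INF_lower) (auto simp: V_def U split: prod.split)
  also have "\<dots> = (\<Sum>i. \<Sum>j. hausdorff_gauge k (U i j))"
    using suminf_ennreal_2dimen[of "\<lambda>i. \<Sum>j. hausdorff_gauge k (U i j)"
        "\<lambda>(i, j). hausdorff_gauge k (U i j)"]
    by (simp add: V_def comp_def case_prod_beta)
  also have "\<dots> \<le> (\<Sum>i. hausdorff_pre k \<delta> (A i) + ennreal (e * (1/2) ^ Suc i))"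
    by (intro suminf_le summableI U)
  also have "\<dots> = (\<Sum>i. hausdorff_pre k \<delta> (A i)) + (\<Sum>i. ennreal (e * (1/2) ^ Suc i))"
    by (intro suminf_add[symmetric] summableI)
  also have "(\<Sum>i. ennreal (e * (1/2) ^ Suc i)) = ennreal e"
    using e sums_mult[OF power_half_series, of e]
    by (intro suminf_ennreal_eq) auto
  finally show "hausdorff_pre k \<delta> (\<Union>i. A i) \<le> (\<Sum>i. hausdorff_pre k \<delta> (A i)) + ennreal e" .
qed

lemma hausdorff_pre_le_outer: "\<delta> > 0 \<Longrightarrow> hausdorff_pre k \<delta> A \<le> hausdorff_outer k A"
  unfolding hausdorff_outer_def by (rule SUP_upper) auto

lemma hausdorff_outer_mono: "A \<subseteq> B \<Longrightarrow> hausdorff_outer k A \<le> hausdorff_outer k B"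
  unfolding hausdorff_outer_def by (intro SUP_mono') (rule hausdorff_pre_mono)

lemma outer_measure_space_hausdorff: "outer_measure_space UNIV (hausdorff_outer k :: 'a::metric_space set \<Rightarrow> ennreal)"
  unfolding outer_measure_space_def
proof (intro conjI)
  show "positive UNIV (hausdorff_outer k :: 'a set \<Rightarrow> _)"
  proof -
    have "hausdorff_outer k ({} :: 'a set) \<le> 0"
      unfolding hausdorff_outer_def by (rule SUP_least) (simp add: hausdorff_pre_empty)
    then show ?thesis by (simp add: positive_def)
  qed
  show "increasing UNIV (hausdorff_outer k :: 'a set \<Rightarrow> _)"
    by (auto simp: increasing_def hausdorff_outer_mono)
  show "countably_subadditive UNIV (hausdorff_outer k :: 'a set \<Rightarrow> _)"
    unfolding countably_subadditive_def
  proof (intro allI impI)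
    fix A :: "nat \<Rightarrow> 'a set"
    show "hausdorff_outer k (\<Union>i. A i) \<le> (\<Sum>i. hausdorff_outer k (A i))"
      unfolding hausdorff_outer_def[of k "\<Union>i. A i"]
    proof (rule SUP_least)
      fix \<delta> :: real assume "\<delta> \<in> {0<..}"
      then show "hausdorff_pre k \<delta> (\<Union>i. A i) \<le> (\<Sum>i. hausdorff_outer k (A i))"
        by (intro order_trans[OF hausdorff_pre_subadditive] suminf_le summableI
              hausdorff_pre_le_outer) auto
    qed
  qed
qed

lemma hausdorff_outer_separated:
  fixes A B :: "'a::metric_space set"
  assumes r: "r > 0" and sep: "\<And>x y. x \<in> A \<Longrightarrow> y \<in> B \<Longrightarrow> r \<le> dist x y"
  shows "hausdorff_outer k A + hausdorff_outer k B \<le> hausdorff_outer k (A \<union> B)"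
proof -
  have pre: "hausdorff_pre k \<delta> A + hausdorff_pre k \<delta> B \<le> hausdorff_pre k \<delta> (A \<union> B)"
    if \<delta>: "0 < \<delta>" "\<delta> < r" for \<delta>
    unfolding hausdorff_pre_def[of k \<delta> "A \<union> B"]
  proof (rule INF_greatest, clarify)
    fix U :: "nat \<Rightarrow> 'a set"
    assume cov: "A \<union> B \<subseteq> (\<Union>i. U i)" and U: "\<forall>i. bounded (U i) \<and> diameter (U i) \<le> \<delta>"
    define V where "V = (\<lambda>S i. if U i \<inter> S = {} then {} else U i)"
    have V: "hausdorff_pre k \<delta> S \<le> (\<Sum>i. hausdorff_gauge k (V S i))" if "S \<subseteq> A \<union> B" for S
      unfolding hausdorff_pre_def
    proof (rule INF_lower, clarsimp, intro conjI allI)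
      show "S \<subseteq> (\<Union>i. V S i)"
        using that cov by (fastforce simp: V_def)
      show "bounded (V S i)" "diameter (V S i) \<le> \<delta>" for i
        using U \<delta> by (auto simp: V_def)
    qed
    have le: "hausdorff_gauge k (V A i) + hausdorff_gauge k (V B i) \<le> hausdorff_gauge k (U i)" for i
    proof (cases "U i \<inter> A = {} \<or> U i \<inter> B = {}")
      case True
      then show ?thesis by (auto simp: V_def hausdorff_gauge_def)
    next
      case False
      then obtain x y where "x \<in> U i" "x \<in> A" "y \<in> U i" "y \<in> B" by blast
      with sep[of x y] diameter_bounded_bound[of "U i" x y] U \<delta> show ?thesis
        by (meson le_less_trans not_le order_trans)
    qed
    have "hausdorff_pre k \<delta> A + hausdorff_pre k \<delta> B
        \<le> (\<Sum>i. hausdorff_gauge k (V A i)) + (\<Sum>i. hausdorff_gauge k (V B i))"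
      by (intro add_mono V) auto
    also have "\<dots> = (\<Sum>i. hausdorff_gauge k (V A i) + hausdorff_gauge k (V B i))"
      by (intro suminf_add summableI)
    also have "\<dots> \<le> (\<Sum>i. hausdorff_gauge k (U i))"
      by (intro suminf_le summableI le)
    finally show "hausdorff_pre k \<delta> A + hausdorff_pre k \<delta> B \<le> (\<Sum>i. hausdorff_gauge k (U i))" .
  qed
  have *: "hausdorff_pre k \<delta>1 A + hausdorff_pre k \<delta>2 B \<le> hausdorff_outer k (A \<union> B)"
    if "0 < \<delta>1" "0 < \<delta>2" for \<delta>1 \<delta>2
  proof -
    define m where "m = min (min \<delta>1 \<delta>2) (r / 2)"
    have m: "0 < m" "m < r" "m \<le> \<delta>1" "m \<le> \<delta>2" using that r by (auto simp: m_def)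
    have "hausdorff_pre k \<delta>1 A + hausdorff_pre k \<delta>2 B \<le> hausdorff_pre k m A + hausdorff_pre k m B"
      by (intro add_mono hausdorff_pre_antimono m)
    also have "\<dots> \<le> hausdorff_outer k (A \<union> B)"
      using pre[OF m(1,2)] hausdorff_pre_le_outer[OF m(1)] by (rule order_trans)
    finally show ?thesis .
  qed
  have ne: "{0<..} \<noteq> ({} :: real set)" using zero_less_one by blast
  have 1: "hausdorff_pre k \<delta>1 A + hausdorff_outer k B \<le> hausdorff_outer k (A \<union> B)"
    if "0 < \<delta>1" for \<delta>1
    unfolding hausdorff_outer_def[of k B] ennreal_SUP_add_right[OF ne]
    by (rule SUP_least) (use * that in auto)
  show ?thesis
    unfolding hausdorff_outer_def[of k A] ennreal_SUP_add_left[OF ne, symmetric]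
    by (rule SUP_least) (use 1 in auto)
qed

lemma metric_outer_measure_closed:
  fixes m :: "'a::metric_space set \<Rightarrow> ennreal"
  assumes oms: "outer_measure_space UNIV m"
    and metric: "\<And>A B r. r > 0 \<Longrightarrow> (\<And>x y. x \<in> A \<Longrightarrow> y \<in> B \<Longrightarrow> r \<le> dist x y) \<Longrightarrow>
      m A + m B \<le> m (A \<union> B)"
    and C: "closed C"
  shows "C \<in> lambda_system UNIV UNIV m"
proof -
  have m0: "m {} = 0" and mono: "\<And>A B. A \<subseteq> B \<Longrightarrow> m A \<le> m B"
    using oms by (auto simp: outer_measure_space_def positive_def increasing_def)
  have csub: "countably_subadditive UNIV m"
    using oms by (simp add: outer_measure_space_def)
  have sub: "m (A \<union> B) \<le> m A + m B" for A B
  proof -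
    have "subadditive UNIV m"
      using ring_of_sets.countably_subadditive_subadditive[OF
          algebra.axioms(1)[OF sigma_algebra.axioms(1)[OF sigma_algebra_Pow]], of UNIV m]
        oms by (simp add: outer_measure_space_def)
    then have "m (A \<union> (B - A)) \<le> m A + m (B - A)"
      by (rule subadditiveD) auto
    also have "\<dots> \<le> m A + m B" by (intro add_left_mono mono) auto
    finally show ?thesis by simp
  qed
  have UN: "m (\<Union>i. A i) \<le> (\<Sum>i. m (A i))" for A :: "nat \<Rightarrow> 'a set"
  proof -
    have "m (\<Union>i. A i) = m (\<Union>i. disjointed A i)" by (simp add: UN_disjointed_eq)
    also have "\<dots> \<le> (\<Sum>i. m (disjointed A i))"
      using csub disjoint_family_disjointed[of A] by (simp add: countably_subadditive_def)
    also have "\<dots> \<le> (\<Sum>i. m (A i))"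
      by (intro suminf_le summableI mono disjointed_subset)
    finally show ?thesis .
  qed
  have main: "m (X \<inter> C) + m (X - C) \<le> m X" for X
  proof (cases "C = {} \<or> m X = top")
    case True
    then show ?thesis by (auto simp: m0)
  next
    case False
    then have ne: "C \<noteq> {}" and fin: "m X < top" by (auto simp: less_top)
    define E where "E n = {x \<in> X. inverse (real (Suc n)) \<le> infdist x C}" for n
    define R where "R n = {x \<in> X. inverse (real (Suc (Suc n))) \<le> infdist x C \<and>
        infdist x C < inverse (real (Suc n))}" for n
    have lip: "infdist x C \<le> infdist y C + dist x y" for x y
      by (rule infdist_triangle)
    have CE: "m (X \<inter> C) + m (E n) \<le> m X" for n
    proof -
      have "m (X \<inter> C) + m (E n) \<le> m ((X \<inter> C) \<union> E n)"
      proof (rule metric)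
        show "inverse (real (Suc n)) > 0" by simp
        fix x y assume "x \<in> X \<inter> C" "y \<in> E n"
        then show "inverse (real (Suc n)) \<le> dist x y"
          using infdist_le[of x C y] by (auto simp: E_def dist_commute)
      qed
      also have "\<dots> \<le> m X" by (rule mono) (auto simp: E_def)
      finally show ?thesis .
    qed
    have par: "(\<Sum>i<N. m (R (2 * i + c))) \<le> m (\<Union>i<N. R (2 * i + c))" for N c
    proof (induction N)
      case 0
      then show ?case by (simp add: m0)
    next
      case (Suc N)
      define r where "r = (inverse (real (2 * N + c)) - inverse (real (Suc (2 * N + c))))"
      have "(\<Sum>i<Suc N. m (R (2 * i + c))) \<le> m (\<Union>i<N. R (2 * i + c)) + m (R (2 * N + c))"
        using Suc by (simp add: add_right_mono)
      also have "\<dots> \<le> m ((\<Union>i<N. R (2 * i + c)) \<union> R (2 * N + c))"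
      proof (cases "N = 0")
        case True
        then show ?thesis by (simp add: m0)
      next
        case False
        show ?thesis
        proof (rule metric)
          show "r > 0" using less_imp_inverse_less[of "real (2 * N + c)" "real (Suc (2 * N + c))"] False
            by (auto simp: r_def)
          fix x y assume "x \<in> (\<Union>i<N. R (2 * i + c))" and y: "y \<in> R (2 * N + c)"
          then obtain i where i: "i < N" "x \<in> R (2 * i + c)" by blast
          have "inverse (real (2 * N + c)) \<le> inverse (real (Suc (Suc (2 * i + c))))"
            using i by (intro le_imp_inverse_le) auto
          also have "\<dots> \<le> infdist x C" using i by (simp add: R_def)
          finally show "r \<le> dist x y"
            using lip[of x y] y by (auto simp: r_def R_def)
        qed
      qed
      also have "(\<Union>i<N. R (2 * i + c)) \<union> R (2 * N + c) = (\<Union>i<Suc N. R (2 * i + c))"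
        by (auto simp: less_Suc_eq)
      finally show ?case .
    qed
    have par': "(\<Sum>i<N. m (R (2 * i + c))) \<le> m X" for N c
      by (rule order_trans[OF par mono]) (auto simp: R_def)
    have "(\<Sum>i<N. m (R i)) \<le> m X + m X" for N
    proof -
      have "(\<Sum>i<N. m (R i)) \<le> (\<Sum>i<2 * N. m (R i))"
        by (rule sum_mono2) auto
      also have "\<dots> = (\<Sum>i<N. m (R (2 * i))) + (\<Sum>i<N. m (R (2 * i + 1)))"
        by (induction N) (auto simp: algebra_simps)
      also have "\<dots> \<le> m X + m X"
        using par'[of 0 N] par'[of 1 N] by (intro add_mono) auto
      finally show ?thesis .
    qed
    then have "(\<Sum>i. m (R i)) \<le> m X + m X"
      by (intro suminf_le_const summableI)
    also have "\<dots> < top" using fin by simp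
    finally have finR: "(\<Sum>i. m (R i)) < top" .
    have cover: "X - C \<subseteq> E n \<union> (\<Union>i. R (i + n))" for n
    proof
      fix x assume x: "x \<in> X - C"
      then have pos: "infdist x C > 0"
        using in_closed_iff_infdist_zero[OF C ne, of x] infdist_nonneg[of x C] by auto
      show "x \<in> E n \<union> (\<Union>i. R (i + n))"
      proof (cases "x \<in> E n")
        case False
        define P where "P j \<longleftrightarrow> inverse (real (Suc j)) \<le> infdist x C" for j
        obtain j0 where "P j0"
          using reals_Archimedean[OF pos] by (auto simp: P_def intro: less_imp_le)
        define j where "j = (LEAST j. P j)"
        have j: "P j" "\<And>i. i < j \<Longrightarrow> \<not> P i"
          unfolding j_def using \<open>P j0\<close> by (auto intro: LeastI dest: not_less_Least)
        have "\<not> P i" if "i \<le> n" for i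
        proof -
          have "inverse (real (Suc n)) \<le> inverse (real (Suc i))"
            using that by (intro le_imp_inverse_le) auto
          moreover have "infdist x C < inverse (real (Suc n))"
            using False x unfolding E_def by auto
          ultimately show ?thesis unfolding P_def by linarith
        qed
        then have "n < j" using j(1) by (meson not_le)
        then obtain i where i: "j = Suc (i + n)" by (metis add.commute less_iff_Suc_add)
        have "x \<in> R (i + n)"
          using x j(1) j(2)[of "i + n"] i by (auto simp: R_def P_def)
        then show ?thesis by blast
      qed auto
    qed
    have bound: "m (X \<inter> C) + m (X - C) \<le> m X + (\<Sum>i. m (R (i + n)))" for n
    proof -
      have "m (X - C) \<le> m (E n \<union> (\<Union>i. R (i + n)))" by (rule mono[OF cover])
      also have "\<dots> \<le> m (E n) + (\<Sum>i. m (R (i + n)))"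
        by (rule order_trans[OF sub add_left_mono[OF UN]])
      finally have "m (X \<inter> C) + m (X - C) \<le> (m (X \<inter> C) + m (E n)) + (\<Sum>i. m (R (i + n)))"
        by (metis add.assoc add_left_mono)
      also have "\<dots> \<le> m X + (\<Sum>i. m (R (i + n)))"
        by (intro add_right_mono CE)
      finally show ?thesis .
    qed
    have "(\<lambda>n. \<Sum>i. m (R (i + n))) \<longlonglongrightarrow> 0"
    proof -
      have fR: "m (R i) < top" for i using ennreal_suminf_lessD[OF finR, of i] by simp
      define f where "f i = enn2real (m (R i))" for i
      have f: "m (R i) = ennreal (f i)" "0 \<le> f i" for i using fR[of i] by (auto simp: f_def)
      have s: "summable f"
        using finR f by (intro summable_suminf_not_top) auto
      have "(\<Sum>i. m (R (i + n))) = ennreal (\<Sum>i. f (i + n))" for n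
        unfolding f(1) using s f(2) by (intro suminf_ennreal2) (auto simp: summable_iff_shift)
      moreover have "(\<lambda>n. ennreal (\<Sum>i. f (i + n))) \<longlonglongrightarrow> ennreal 0"
        using suminf_exist_split2[OF s] by (intro tendsto_ennrealI)
      ultimately show ?thesis by simp
    qed
    then have "(\<lambda>n. m X + (\<Sum>i. m (R (i + n)))) \<longlonglongrightarrow> m X + 0"
      by (intro tendsto_add tendsto_const)
    then show ?thesis
      using bound by (intro LIMSEQ_le_const[of _ "m X"]) auto
  qed
  have "m (C \<inter> X) + m ((UNIV - C) \<inter> X) = m X" for X
  proof (rule antisym)
    have "C \<inter> X = X \<inter> C" "(UNIV - C) \<inter> X = X - C" by auto
    with main[of X] show "m (C \<inter> X) + m ((UNIV - C) \<inter> X) \<le> m X" by simp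
    have "m X = m ((C \<inter> X) \<union> ((UNIV - C) \<inter> X))" by (rule arg_cong[of _ _ m]) auto
    also have "\<dots> \<le> m (C \<inter> X) + m ((UNIV - C) \<inter> X)" by (rule sub)
    finally show "m X \<le> m (C \<inter> X) + m ((UNIV - C) \<inter> X)" .
  qed
  then show ?thesis by (auto simp: lambda_system_def)
qed

lemma measure_space_hausdorff:
  "measure_space UNIV (sets borel) (hausdorff_outer k :: 'a::metric_space set \<Rightarrow> ennreal)"
proof -
  let ?m = "hausdorff_outer k :: 'a set \<Rightarrow> ennreal"
  have oms: "outer_measure_space UNIV ?m"
    by (rule outer_measure_space_hausdorff)
  have sa: "sigma_algebra (UNIV :: 'a set) UNIV"
    using sigma_algebra_Pow[of UNIV] by simp
  have ms: "measure_space UNIV (lambda_system UNIV UNIV ?m) ?m"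
    by (rule sigma_algebra.caratheodory_lemma[OF sa oms])
  then have sa': "sigma_algebra UNIV (lambda_system UNIV UNIV ?m)"
    by (simp add: measure_space_def)
  have "sets borel = sigma_sets UNIV {C :: 'a set. closed C}"
    unfolding borel_eq_closed by simp
  also have "\<dots> \<subseteq> lambda_system UNIV UNIV ?m"
    by (rule sigma_algebra.sigma_sets_subset[OF sa'])
       (auto intro!: metric_outer_measure_closed[OF oms] intro: hausdorff_outer_separated)
  finally show ?thesis
    using measure_down[OF ms] sets.sigma_algebra_axioms[of "borel :: 'a measure"] by simp
qed

lemma sets_hausdorff_measure [simp, measurable_cong]:
  "sets (hausdorff_measure k :: 'a::metric_space measure) = sets borel"
  unfolding hausdorff_measure_def
  using sets.sigma_sets_eq[of "borel :: 'a measure"] by (subst sets_measure_of) auto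

lemma space_hausdorff_measure [simp]:
  "space (hausdorff_measure k :: 'a::metric_space measure) = UNIV"
  unfolding hausdorff_measure_def by (simp add: space_measure_of)

lemma emeasure_hausdorff_measure:
  "A \<in> sets borel \<Longrightarrow> emeasure (hausdorff_measure k) A = hausdorff_outer k A"
  for A :: "'a::metric_space set"
  using measure_space_hausdorff[of k, where 'a = 'a]
  by (intro emeasure_measure_of[OF hausdorff_measure_def])
     (auto simp: measure_space_def)

section \<open>Wasserstein and sliced Wasserstein distances\<close>

text \<open>
  Exponents in \<open>[1, \<infinity>]\<close> are elements of \<^typ>\<open>ennreal\<close>; the distances are \<^typ>\<open>ennreal\<close>-valued, which
  avoids arbitrary values for suprema and integrals. They are finite on \<open>wspace p\<close>.
\<close>

text \<open>For \<open>a > 0\<close> only: \<open>\<infinity>\<^sup>a = \<infinity>\<close>.\<close>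

definition ennreal_powr :: "ennreal \<Rightarrow> real \<Rightarrow> ennreal" where
  "ennreal_powr x a = (if x = \<infinity> then \<infinity> else ennreal (enn2real x powr a))"

definition measure_support :: "'a::topological_space measure \<Rightarrow> 'a set" where
  "measure_support \<mu> = {x. \<forall>U. open U \<and> x \<in> U \<longrightarrow> emeasure \<mu> U > 0}"

definition wspace :: "ennreal \<Rightarrow> 'a::euclidean_space measure set" where
  "wspace p = {\<mu>. sets \<mu> = sets borel \<and> prob_space \<mu> \<and>
    (if p = \<infinity> then bounded (measure_support \<mu>)
     else (\<integral>\<^sup>+ x. ennreal (norm x powr enn2real p) \<partial>\<mu>) < \<infinity>)}"

definition couplings :: "'a::second_countable_topology measure \<Rightarrow> 'a measure \<Rightarrow> ('a \<times> 'a) measure set" where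
  "couplings \<mu> \<nu> = {\<gamma>. sets \<gamma> = sets borel \<and> distr \<gamma> borel fst = \<mu> \<and> distr \<gamma> borel snd = \<nu>}"

definition wasserstein ::
    "ennreal \<Rightarrow> 'a::{metric_space, second_countable_topology} measure \<Rightarrow> 'a measure \<Rightarrow> ennreal" where
  "wasserstein p \<mu> \<nu> =
    (if p = \<infinity> then (INF \<gamma> \<in> couplings \<mu> \<nu>. esssup \<gamma> (\<lambda>(x, y). ennreal (dist x y)))
     else ennreal_powr
       (INF \<gamma> \<in> couplings \<mu> \<nu>. \<integral>\<^sup>+ (x, y). ennreal (dist x y powr enn2real p) \<partial>\<gamma>)
       (1 / enn2real p))"

definition slice :: "'a::euclidean_space \<Rightarrow> 'a measure \<Rightarrow> real measure" where
  "slice \<theta> \<mu> = distr \<mu> borel (\<lambda>x. x \<bullet> \<theta>)"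

definition sliced_wasserstein ::
    "ennreal \<Rightarrow> ennreal \<Rightarrow> 'a::euclidean_space measure \<Rightarrow> 'a measure \<Rightarrow> ennreal" where
  "sliced_wasserstein p q \<mu> \<nu> =
    (if q = \<infinity> then (SUP \<theta> \<in> sphere 0 1. wasserstein p (slice \<theta> \<mu>) (slice \<theta> \<nu>))
     else ennreal_powr
       ((\<integral>\<^sup>+ \<theta> \<in> sphere 0 1. ennreal_powr (wasserstein p (slice \<theta> \<mu>) (slice \<theta> \<nu>)) (enn2real q)
           \<partial>hausdorff_measure (DIM('a) - 1))
         / emeasure (hausdorff_measure (DIM('a) - 1)) (sphere 0 1 :: 'a set))
       (1 / enn2real q))"

definition bi_lipschitz_equivalent ::
    "'b set \<Rightarrow> ('b \<Rightarrow> 'b \<Rightarrow> ennreal) \<Rightarrow> ('b \<Rightarrow> 'b \<Rightarrow> ennreal) \<Rightarrow> bool" where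
  "bi_lipschitz_equivalent X \<rho>1 \<rho>2 \<longleftrightarrow>
    (\<exists>C::real. C \<ge> 1 \<and> (\<forall>\<mu>\<in>X. \<forall>\<nu>\<in>X.
      ennreal (inverse C) * \<rho>1 \<mu> \<nu> \<le> \<rho>2 \<mu> \<nu> \<and> \<rho>2 \<mu> \<nu> \<le> ennreal C * \<rho>1 \<mu> \<nu>))"

end

theory Submission
  imports Defs "HOL-Real_Asymp.Real_Asymp"
begin

text \<open>
  A sliced distance only sees the masses of half-spaces, whereas \<open>W\<^sub>1\<close> sees every local displacement
  of mass. The two are separated by point sets that are locally displaced but whose half-space
  counts nearly agree.

  Take two orthonormal vectors \<open>e\<close>, \<open>f\<close> and, in the plane they span, the \<open>N\<^sup>2\<close> cells with lower left
  corners \<open>(a, b)\<close>, \<open>0 \<le> a, b < N\<close>. Each cell carries the two points \<open>(a, b)\<close> and \<open>(a + 1/2, b)\<close>; a sign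
  \<open>\<sigma> (a, b)\<close> decides which of them goes to \<open>\<mu>\<close>, and the other one goes to \<open>\<nu>\<close>. Both measures also get the
  same background, about \<open>16 N\<^sup>2\<close> points spaced \<open>1/N\<close> apart on the two coordinate axes, and are
  normalised to mass one.

  Every point of \<open>\<nu>\<close> in a cell is at distance at least \<open>1/2\<close> from all the cell points of \<open>\<mu>\<close>. Integrating
  the distance to the latter set shows \<open>W\<^sub>p \<mu> \<nu> \<ge> W\<^sub>1 \<mu> \<nu> \<ge> 1/38\<close> for all signs and all \<open>p\<close>
  (\<open>wasserstein_config_ge\<close>); the background contributes equally to the integrals against \<open>\<mu>\<close> and \<open>\<nu>\<close> and
  cancels.

  For the slices, a line separates the two points of at most \<open>N\<close> cells, at most one per row
  (\<open>card_separated_cells_le\<close>). So for random signs the counts of \<open>\<mu>\<close> and \<open>\<nu>\<close> in a half-plane differ by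
  about \<open>\<surd>N\<close>, and, up to a logarithm, this holds for polynomially many half-planes simultaneously. All that
  is needed is a bound \<open>o(N)\<close>, which a deterministic choice of signs achieves
  (\<open>exists_balancing_signs\<close>). Here the background comes in: in any direction of the plane, every window of length
  \<open>\<delta>\<close> in the relevant range contains about \<open>\<delta> N\<close> projected background points or more, so a surplus of \<open>o(N)\<close> cell points
  is compensated by a shift of length \<open>o(1)\<close>. Hence the distribution functions of the slices interlace up
  to a shift by an arbitrarily small \<open>\<delta>\<close> (\<open>exists_interlacing_signs\<close>), and coupling the slices by their quantile
  functions gives \<open>W\<^sub>\<infinity> \<le> \<delta>\<close> in all directions at once (\<open>wasserstein_le_of_cdf_interlace\<close>). As
  \<open>W\<^sub>p \<le> W\<^sub>\<infinity>\<close> and an average is at most a supremum, \<open>SW\<^sub>p\<^sub>,\<^sub>q \<mu> \<nu> \<le> \<delta>\<close> for all exponents, and \<open>\<delta>\<close> is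
  arbitrary while \<open>W\<^sub>p\<close> stays bounded below.
\<close>

section \<open>Balancing signs\<close>

text \<open>
  The estimate of the moment generating function of a random sign that drives Hoeffding's inequality.
  The optimal exponent is \<open>x\<^sup>2 / 2\<close>; constants are irrelevant below.
\<close>

lemma cosh_le_exp_square:
  fixes x :: real
  assumes "\<bar>x\<bar> \<le> 1"
  shows "cosh x \<le> exp (x\<^sup>2)"
proof -
  have main: "cosh y \<le> 1 + y\<^sup>2" if y: "0 \<le> y" "y \<le> 1" for y :: real
  proof -
    have "exp (- y) \<le> 1 / (1 + y)"
      using exp_ge_add_one_self[of y] y by (simp add: exp_minus inverse_eq_divide frac_le)
    also have "\<dots> \<le> 1 - y + y\<^sup>2"
    proof -
      have "1 \<le> (1 - y + y\<^sup>2) * (1 + y)"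
        using y by (simp add: algebra_simps power2_eq_square)
      then show ?thesis
        using y by (simp add: divide_le_eq)
    qed
    finally show ?thesis
      using exp_bound[of y] y by (simp add: cosh_def field_simps)
  qed
  have "cosh x = cosh \<bar>x\<bar>"
    by (simp add: abs_if)
  also have "\<dots> \<le> 1 + x\<^sup>2"
    using main[of "\<bar>x\<bar>"] assms by simp
  also have "\<dots> \<le> exp (x\<^sup>2)"
    by (rule exp_ge_add_one_self)
  finally show ?thesis .
qed

text \<open>
  If the signs \<open>\<sigma>\<close> are independent and fair, the right-hand side is the expectation of the left-hand side,
  so some choice of signs does not exceed it. Instead of probabilities, the proof fixes the signs one after the
  other: by \<open>cosh (x + y) + cosh (x - y) = 2 cosh x cosh y\<close> one of the two values for the next sign does not
  exceed the average. Arbitrary weights are what makes the induction work, because the factor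
  \<open>cosh (l c\<^sub>i)\<close> of the new index is absorbed into them.
\<close>

lemma exists_signs_cosh_le_prod:
  fixes c :: "'h \<Rightarrow> 'i \<Rightarrow> real"
  assumes "finite I" and "\<And>h. h \<in> H \<Longrightarrow> 0 \<le> w h"
  shows "\<exists>\<sigma>. (\<Sum>h\<in>H. w h * cosh (l * (\<Sum>i\<in>I. if \<sigma> i then c h i else - c h i)))
      \<le> (\<Sum>h\<in>H. w h * (\<Prod>i\<in>I. cosh (l * c h i)))"
  using assms
proof (induction I arbitrary: w rule: finite_induct)
  case empty
  then show ?case by simp
next
  case (insert i I)
  define S where "S \<sigma> h = (\<Sum>i\<in>I. if \<sigma> i then c h i else - c h i)" for \<sigma> h
  obtain \<sigma> where \<sigma>: "(\<Sum>h\<in>H. (w h * cosh (l * c h i)) * cosh (l * S \<sigma> h))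
      \<le> (\<Sum>h\<in>H. (w h * cosh (l * c h i)) * (\<Prod>i\<in>I. cosh (l * c h i)))"
    using insert.IH[of "\<lambda>h. w h * cosh (l * c h i)"] insert.prems
    unfolding S_def by (auto simp: cosh_real_nonneg)
  define V where "V b = (\<Sum>h\<in>H. w h * cosh (l * ((if b then c h i else - c h i) + S \<sigma> h)))" for b
  \<comment> \<open>The average of the two extensions is the potential without the new index, with updated weights.\<close>
  have "V True + V False = (\<Sum>h\<in>H. w h * (2 * cosh (l * c h i) * cosh (l * S \<sigma> h)))"
    unfolding V_def sum.distrib[symmetric]
    by (intro sum.cong) (auto simp: cosh_add cosh_diff algebra_simps)
  also have "\<dots> = 2 * (\<Sum>h\<in>H. (w h * cosh (l * c h i)) * cosh (l * S \<sigma> h))"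
    by (simp add: sum_distrib_left mult_ac)
  finally have "V True \<le> (\<Sum>h\<in>H. (w h * cosh (l * c h i)) * cosh (l * S \<sigma> h)) \<or>
      V False \<le> (\<Sum>h\<in>H. (w h * cosh (l * c h i)) * cosh (l * S \<sigma> h))"
    by linarith
  then obtain b where b: "V b \<le> (\<Sum>h\<in>H. (w h * cosh (l * c h i)) * cosh (l * S \<sigma> h))"
    by blast
  have "S (\<sigma>(i := b)) h = S \<sigma> h" for h
    unfolding S_def using insert.hyps by (intro sum.cong) auto
  then have "(\<Sum>h\<in>H. w h * cosh (l * (\<Sum>i'\<in>insert i I.
      if (\<sigma>(i := b)) i' then c h i' else - c h i'))) = V b"
    using insert.hyps by (simp add: V_def S_def)
  also have "\<dots> \<le> (\<Sum>h\<in>H. w h * (\<Prod>i\<in>insert i I. cosh (l * c h i)))"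
    using order_trans[OF b \<sigma>] insert.hyps by (simp add: mult.assoc)
  finally show ?case by blast
qed

text \<open>
  A derandomised form of Hoeffding's inequality with a union bound over \<open>H\<close>: each signed sum is controlled
  by the exponential potential \<open>\<Sum>\<^sub>h cosh (l x\<^sub>h)\<close>, and the factors of \<open>exists_signs_cosh_le_prod\<close>
  with vanishing coefficient are equal to 1. The parameter \<open>l\<close> is left free; it will be a small constant, which makes
  the bound small compared with \<open>s\<close>.
\<close>

lemma exists_balancing_signs:
  fixes c :: "'h \<Rightarrow> 'i \<Rightarrow> real"
  assumes "finite I" and "finite H" and l: "0 < l" "l \<le> 1"
    and bound: "\<And>h i. h \<in> H \<Longrightarrow> i \<in> I \<Longrightarrow> \<bar>c h i\<bar> \<le> 1"
    and sparse: "\<And>h. h \<in> H \<Longrightarrow> card {i\<in>I. c h i \<noteq> 0} \<le> s"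
  shows "\<exists>\<sigma>. \<forall>h\<in>H. \<bar>\<Sum>i\<in>I. if \<sigma> i then c h i else - c h i\<bar> \<le> ln (2 * card H) / l + l * s"
proof -
  have prod_le: "(\<Prod>i\<in>I. cosh (l * c h i)) \<le> exp (l\<^sup>2 * s)" if h: "h \<in> H" for h
  proof -
    have "(\<Prod>i\<in>I. cosh (l * c h i)) = (\<Prod>i\<in>{i\<in>I. c h i \<noteq> 0}. cosh (l * c h i))"
      using \<open>finite I\<close> by (intro prod.mono_neutral_right) auto
    also have "\<dots> \<le> (\<Prod>i\<in>{i\<in>I. c h i \<noteq> 0}. exp (l\<^sup>2))"
    proof (intro prod_mono conjI)
      fix i assume "i \<in> {i\<in>I. c h i \<noteq> 0}"
      then have c: "\<bar>c h i\<bar> \<le> 1" using bound h by auto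
      then have "\<bar>l * c h i\<bar> \<le> 1"
        using l by (simp add: abs_mult mult_le_one)
      then have "cosh (l * c h i) \<le> exp ((l * c h i)\<^sup>2)"
        by (rule cosh_le_exp_square)
      also have "\<dots> \<le> exp (l\<^sup>2)"
        using c l by (simp add: power_mult_distrib mult_left_le abs_square_le_1)
      finally show "cosh (l * c h i) \<le> exp (l\<^sup>2)" .
    qed (simp add: cosh_real_nonneg)
    also have "\<dots> = exp (l\<^sup>2 * card {i\<in>I. c h i \<noteq> 0})"
      by (simp add: exp_of_nat2_mult)
    also have "\<dots> \<le> exp (l\<^sup>2 * s)"
      using sparse[OF h] by (simp add: mult_left_mono)
    finally show ?thesis .
  qed
  obtain \<sigma> where "(\<Sum>h\<in>H. 1 * cosh (l * (\<Sum>i\<in>I. if \<sigma> i then c h i else - c h i)))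
      \<le> (\<Sum>h\<in>H. 1 * (\<Prod>i\<in>I. cosh (l * c h i)))"
    using exists_signs_cosh_le_prod[OF \<open>finite I\<close>, of H "\<lambda>_. 1"] by auto
  then have total: "(\<Sum>h\<in>H. cosh (l * (\<Sum>i\<in>I. if \<sigma> i then c h i else - c h i)))
      \<le> card H * exp (l\<^sup>2 * s)"
    using sum_mono[of H "\<lambda>h. \<Prod>i\<in>I. cosh (l * c h i)" "\<lambda>_. exp (l\<^sup>2 * s)"] prod_le by auto
  have "\<bar>\<Sum>i\<in>I. if \<sigma> i then c h i else - c h i\<bar> \<le> ln (2 * card H) / l + l * s" if h: "h \<in> H" for h
  proof -
    define x where "x = (\<Sum>i\<in>I. if \<sigma> i then c h i else - c h i)"
    have card: "card H > 0"
      using h \<open>finite H\<close> by (auto simp: card_gt_0_iff)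
    have "exp (l * \<bar>x\<bar>) \<le> 2 * cosh (l * \<bar>x\<bar>)"
      by (simp add: cosh_def)
    also have "cosh (l * \<bar>x\<bar>) = cosh (l * x)"
      by (simp add: abs_if)
    also have "cosh (l * x) \<le> card H * exp (l\<^sup>2 * s)"
      unfolding x_def
      by (rule order_trans[OF member_le_sum[OF h] total]) (auto simp: \<open>finite H\<close> cosh_real_nonneg)
    finally have "l * \<bar>x\<bar> \<le> ln (2 * (card H * exp (l\<^sup>2 * s)))"
      using card by (subst ln_ge_iff) auto
    also have "\<dots> = ln (2 * card H) + l\<^sup>2 * s"
      using card by (simp add: ln_mult mult.assoc[symmetric])
    finally show ?thesis
      using l unfolding x_def[symmetric] by (simp add: field_simps power2_eq_square)
  qed
  then show ?thesis by blast
qed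

section \<open>Half-plane counts of the cell points\<close>

definition cells :: "nat \<Rightarrow> (nat \<times> nat) set" where
  "cells N = {..<N} \<times> {..<N}"

text \<open>
  The inner product of \<open>(u, v)\<close> with the point \<open>(a, b)\<close> or \<open>(a + 1/2, b)\<close> of the cell \<open>c = (a, b)\<close>; the flag \<open>s\<close>
  says whether the lattice point itself is meant.
\<close>

definition cell_height :: "bool \<Rightarrow> real \<Rightarrow> real \<Rightarrow> nat \<times> nat \<Rightarrow> real" where
  "cell_height s u v c = (real (fst c) + (if s then 0 else 1 / 2)) * u + real (snd c) * v"

definition cell_count :: "nat \<Rightarrow> (nat \<times> nat \<Rightarrow> bool) \<Rightarrow> real \<Rightarrow> real \<Rightarrow> real \<Rightarrow> nat" where
  "cell_count N \<rho> u v t = card {c \<in> cells N. cell_height (\<rho> c) u v c \<le> t}"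

lemma finite_cells [simp]: "finite (cells N)"
  by (simp add: cells_def)

text \<open>
  Along a row, the value \<open>a u + b v\<close> changes by \<open>u\<close> from one cell to the next but only by \<open>u / 2\<close> within a
  cell, so the level \<open>t\<close> is crossed inside at most one cell of the row.
\<close>

lemma card_separated_cells_le:
  "card {c \<in> cells N. (cell_height True u v c \<le> t) \<noteq> (cell_height False u v c \<le> t)} \<le> N"
    (is "card ?D \<le> N")
proof -
  have "a' \<le> a" if "(a, b) \<in> ?D" "(a', b) \<in> ?D" for a a' b
  proof (rule ccontr)
    assume "\<not> a' \<le> a"
    then have a: "real a + 1 \<le> real a'" by linarith
    have "(real a + 1) * \<bar>u\<bar> \<le> real a' * \<bar>u\<bar>"
      by (rule mult_right_mono[OF a]) simp
    then show False
      using that by (cases "u \<ge> 0") (auto simp: cell_height_def algebra_simps)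
  qed
  then have eq: "a = a'" if "(a, b) \<in> ?D" "(a', b) \<in> ?D" for a a' b
    using that by (meson antisym)
  have "inj_on snd ?D"
  proof (rule inj_onI)
    fix p q assume pq: "p \<in> ?D" "q \<in> ?D" "snd p = snd q"
    obtain a b a' where p: "p = (a, b)" and q: "q = (a', b)"
      using pq(3) by (cases p, cases q) simp
    have "a = a'"
      using pq(1,2) unfolding p q by (rule eq)
    then show "p = q"
      by (simp add: p q)
  qed
  moreover have "snd ` ?D \<subseteq> {..<N}"
    by (auto simp: cells_def)
  ultimately show ?thesis
    using card_inj_on_le[of snd ?D "{..<N}"] by simp
qed

text \<open>
  A triple \<open>(j, k, z)\<close> stands for the half-plane of all \<open>(x, y)\<close> with \<open>j x + k y \<le> z\<close>. These half-planes
  approximate those with normal vector in \<open>[-1, 1]\<^sup>2\<close> and level in \<open>[-2 N, 2 N]\<close>, rescaled by \<open>N\<^sup>2\<close>. The net has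
  at most \<open>45 N\<^sup>7\<close> elements.
\<close>

definition halfplane_net :: "nat \<Rightarrow> (int \<times> int \<times> int) set" where
  "halfplane_net N = {- (int N ^ 2)..int N ^ 2} \<times> {- (int N ^ 2)..int N ^ 2} \<times> {- (2 * int N ^ 3)..2 * int N ^ 3}"

lemma exists_signs_balancing_halfplane_net:
  assumes "N > 0" and l: "0 < l" "l \<le> 1"
  shows "\<exists>\<sigma>. \<forall>(j, k, z) \<in> halfplane_net N.
    \<bar>real (cell_count N \<sigma> j k z) - real (cell_count N (\<lambda>c. \<not> \<sigma> c) j k z)\<bar>
      \<le> ln (90 * N ^ 7) / l + l * N"
proof -
  let ?n = "int N"
  define H where "H = halfplane_net N"
  define c where "c = (\<lambda>(j :: int, k :: int, z :: int) i.
    of_bool (cell_height True j k i \<le> z) - of_bool (cell_height False j k i \<le> z) :: real)"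
  have n1: "1 \<le> int N" using \<open>N > 0\<close> by simp
  have "int (card H) = (2 * ?n\<^sup>2 + 1) * ((2 * ?n\<^sup>2 + 1) * (4 * ?n ^ 3 + 1))"
    by (simp add: H_def halfplane_net_def card_cartesian_product algebra_simps)
  also have "\<dots> \<le> (3 * ?n\<^sup>2) * ((3 * ?n\<^sup>2) * (5 * ?n ^ 3))"
    using n1 one_le_power[OF n1, of 2] one_le_power[OF n1, of 3] by (intro mult_mono) auto
  also have "\<dots> = 45 * ?n ^ 7"
    by (simp add: eval_nat_numeral)
  finally have "card H \<le> 45 * N ^ 7"
    by (metis of_nat_le_iff of_nat_mult of_nat_numeral of_nat_power)
  then have H_card: "real (card H) \<le> 45 * real N ^ 7"
    by (metis of_nat_le_iff of_nat_mult of_nat_numeral of_nat_power)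
  have "(0, 0, 0) \<in> H" by (simp add: H_def halfplane_net_def)
  moreover have H_fin: "finite H" by (simp add: H_def halfplane_net_def)
  ultimately have H_pos: "card H > 0" by (auto simp: card_gt_0_iff)
  have "\<exists>\<sigma>. \<forall>h\<in>H. \<bar>\<Sum>i\<in>cells N. if \<sigma> i then c h i else - c h i\<bar> \<le> ln (2 * card H) / l + l * N"
  proof (rule exists_balancing_signs[OF finite_cells H_fin l])
    fix h assume "h \<in> H"
    obtain j k z where h: "h = (j, k, z)" by (cases h)
    have "{i \<in> cells N. c h i \<noteq> 0} = {i \<in> cells N.
        (cell_height True j k i \<le> z) \<noteq> (cell_height False j k i \<le> z)}"
      by (auto simp: c_def h)
    then show "card {i \<in> cells N. c h i \<noteq> 0} \<le> N"
      using card_separated_cells_le[of N j k z] by simp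
  qed (auto simp: c_def)
  then obtain \<sigma> where \<sigma>: "\<And>h. h \<in> H \<Longrightarrow>
      \<bar>\<Sum>i\<in>cells N. if \<sigma> i then c h i else - c h i\<bar> \<le> ln (2 * card H) / l + l * N"
    by blast
  have "\<bar>real (cell_count N \<sigma> j k z) - real (cell_count N (\<lambda>c. \<not> \<sigma> c) j k z)\<bar>
      \<le> ln (90 * N ^ 7) / l + l * N"
    if jkz: "(j, k, z) \<in> H" for j k z
  proof -
    have cnt: "real (cell_count N \<rho> j k z) = (\<Sum>i\<in>cells N. of_bool (cell_height (\<rho> i) j k i \<le> z))" for \<rho>
      by (simp add: cell_count_def sum_of_bool_eq Int_def)
    have "real (cell_count N \<sigma> j k z) - real (cell_count N (\<lambda>c. \<not> \<sigma> c) j k z)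
        = (\<Sum>i\<in>cells N. if \<sigma> i then c (j, k, z) i else - c (j, k, z) i)"
      unfolding cnt sum_subtractf[symmetric] by (intro sum.cong) (auto simp: c_def)
    moreover have "ln (2 * card H) \<le> ln (90 * real N ^ 7)"
      using H_pos H_card by (intro ln_mono) auto
    ultimately show ?thesis
      using \<sigma>[OF jkz] l divide_right_mono[of "ln (2 * card H)" "ln (90 * real N ^ 7)" l] by simp
  qed
  then show ?thesis by (auto simp: H_def)
qed

lemma cell_count_mono: "t \<le> t' \<Longrightarrow> cell_count N \<rho> u v t \<le> cell_count N \<rho> u v t'"
  unfolding cell_count_def by (rule card_mono) auto

text \<open>
  Moving from the net to all half-planes costs a shift of \<open>3 / N\<close> in the level. Rounding \<open>N\<^sup>2 (u, v)\<close> down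
  changes heights in one direction only, because the coordinates of the cell points are nonnegative, and the change
  is at most \<open>2 N\<close> as these coordinates are at most \<open>N\<close>; rounding \<open>N\<^sup>2 t\<close> up adds at most 1.
\<close>

lemma cell_count_le_by_rounding:
  assumes N: "N > 0"
    and net: "\<And>j k z. (j, k, z) \<in> halfplane_net N \<Longrightarrow>
      real (cell_count N \<rho> j k z) \<le> real (cell_count N \<rho>' j k z) + D"
    and u: "\<bar>u\<bar> \<le> 1" and v: "\<bar>v\<bar> \<le> 1" and t: "\<bar>t\<bar> \<le> 2 * N"
  shows "real (cell_count N \<rho> u v t) \<le> real (cell_count N \<rho>' u v (t + 3 / N)) + D"
proof -
  define j k z where "j = \<lfloor>u * N\<^sup>2\<rfloor>" and "k = \<lfloor>v * N\<^sup>2\<rfloor>" and "z = \<lceil>t * N\<^sup>2\<rceil>"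
  have n0: "real N > 0" and n1: "real N \<ge> 1" using N by auto
  have round_range: "\<bar>\<lfloor>w * real_of_int m\<rfloor>\<bar> \<le> m" if "\<bar>w\<bar> \<le> 1" "m \<ge> 0" for w and m :: int
  proof -
    have "\<bar>w * m\<bar> \<le> m"
      using that by (simp add: abs_mult mult_left_le_one_le)
    then show ?thesis
      by (simp add: abs_le_iff le_floor_iff floor_le_iff) linarith
  qed
  have jr: "\<bar>j\<bar> \<le> int N ^ 2" and kr: "\<bar>k\<bar> \<le> int N ^ 2"
    using round_range[OF u, of "int N ^ 2"] round_range[OF v, of "int N ^ 2"]
    by (simp_all add: j_def k_def)
  have "\<bar>t * N\<^sup>2\<bar> \<le> 2 * N * N\<^sup>2"
    using mult_right_mono[OF t, of "real N ^ 2"] by (simp add: abs_mult)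
  then have "\<bar>t * N\<^sup>2\<bar> \<le> real_of_int (2 * int N ^ 3)"
    by (simp add: power2_eq_square power3_eq_cube mult_ac)
  then have zr: "\<bar>z\<bar> \<le> 2 * int N ^ 3"
    unfolding z_def abs_le_iff minus_le_iff[of _ "2 * int N ^ 3"] ceiling_le_iff le_ceiling_iff
    by simp
  have jb: "j \<le> u * N\<^sup>2" "u * N\<^sup>2 \<le> j + 1" and kb: "k \<le> v * N\<^sup>2" "v * N\<^sup>2 \<le> k + 1"
    and zb: "t * N\<^sup>2 \<le> z" "z \<le> t * N\<^sup>2 + 1"
    unfolding j_def k_def z_def by linarith+
  have height: "cell_height s j k c \<le> N\<^sup>2 * cell_height s u v c"
    "N\<^sup>2 * cell_height s u v c \<le> cell_height s j k c + 2 * N" if "c \<in> cells N" for s c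
  proof -
    define x y where "x = real (fst c) + (if s then 0 else 1 / 2)" and "y = real (snd c)"
    have "fst c + 1 \<le> N" "snd c + 1 \<le> N"
      using that by (auto simp: cells_def)
    then have "real (fst c) + 1 \<le> N" "real (snd c) + 1 \<le> N"
      by linarith+
    then have xy: "0 \<le> x" "x \<le> N" "0 \<le> y" "y \<le> N"
      by (auto simp: x_def y_def)
    have h: "cell_height s u' v' c = x * u' + y * v'" for u' v'
      by (simp add: cell_height_def x_def y_def)
    show "cell_height s j k c \<le> N\<^sup>2 * cell_height s u v c"
      using mult_left_mono[OF jb(1) xy(1)] mult_left_mono[OF kb(1) xy(3)]
      unfolding h by (simp add: algebra_simps)
    show "N\<^sup>2 * cell_height s u v c \<le> cell_height s j k c + 2 * N"
      using mult_left_mono[OF jb(2) xy(1)] mult_left_mono[OF kb(2) xy(3)] xy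
      unfolding h by (simp add: algebra_simps)
  qed
  have n2: "(real N)\<^sup>2 > 0" using n0 by simp
  have "cell_count N \<rho> u v t \<le> cell_count N \<rho> j k z"
    unfolding cell_count_def
  proof (rule card_mono, simp, clarify)
    fix a b assume c: "(a, b) \<in> cells N" "cell_height (\<rho> (a, b)) u v (a, b) \<le> t"
    then have "N\<^sup>2 * cell_height (\<rho> (a, b)) u v (a, b) \<le> t * N\<^sup>2"
      using n2 by (simp add: mult.commute)
    then show "cell_height (\<rho> (a, b)) j k (a, b) \<le> z"
      using height(1)[OF c(1), of "\<rho> (a, b)"] zb by linarith
  qed
  also have "real (cell_count N \<rho> j k z) \<le> real (cell_count N \<rho>' j k z) + D"
    by (rule net) (use jr kr zr in \<open>auto simp: halfplane_net_def abs_le_iff\<close>)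
  also have "cell_count N \<rho>' j k z \<le> cell_count N \<rho>' u v (t + 3 / N)"
    unfolding cell_count_def
  proof (rule card_mono, simp, clarify)
    fix a b assume c: "(a, b) \<in> cells N" "cell_height (\<rho>' (a, b)) j k (a, b) \<le> z"
    then have "N\<^sup>2 * cell_height (\<rho>' (a, b)) u v (a, b) \<le> t * N\<^sup>2 + 1 + 2 * N"
      using height(2)[OF c(1), of "\<rho>' (a, b)"] zb by linarith
    also have "\<dots> \<le> N\<^sup>2 * (t + 3 / N)"
      using n1 by (simp add: field_simps power2_eq_square)
    finally show "cell_height (\<rho>' (a, b)) u v (a, b) \<le> t + 3 / N"
      using n2 by simp
  qed
  finally show ?thesis by simp
qed

section \<open>Compensation by the background\<close>

text \<open>
  The background points are the multiples \<open>k / N\<close> of the two unit vectors. They reach out to distance \<open>4 N\<close>, beyond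
  the levels in \<open>[-2 N, 2 N]\<close> at which a line may cut the cells.
\<close>

definition axis_indices :: "nat \<Rightarrow> int set" where
  "axis_indices N = {- (4 * int N ^ 2)..4 * int N ^ 2}"

definition axis_count :: "nat \<Rightarrow> real \<Rightarrow> real \<Rightarrow> nat" where
  "axis_count N u t = card {k \<in> axis_indices N. real_of_int k / N * u \<le> t}"

lemma finite_axis_indices [simp]: "finite (axis_indices N)"
  by (simp add: axis_indices_def)

lemma axis_count_mono: "t \<le> t' \<Longrightarrow> axis_count N u t \<le> axis_count N u t'"
  unfolding axis_count_def by (rule card_mono) auto

lemma axis_count_growth:
  assumes N: "N > 0" and u: "\<bar>u\<bar> = 1" and t: "- 4 * real N \<le> t" "t + h \<le> 4 * N" and h: "h \<ge> 0"
  shows "real (axis_count N u t) + (h * N - 1) \<le> real (axis_count N u (t + h))"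
proof -
  have n0: "real N > 0" using N by simp
  have one: "int (axis_count N 1 s) = \<lfloor>s * N\<rfloor> + 4 * int N ^ 2 + 1"
    if s: "- 4 * real N \<le> s" "s \<le> 4 * N" for s
  proof -
    have lo: "- (4 * int N ^ 2) \<le> \<lfloor>s * N\<rfloor>"
      using mult_right_mono[OF s(1), of "real N"] by (simp add: le_floor_iff power2_eq_square)
    have "s * N \<le> 4 * (real N)\<^sup>2"
      using mult_right_mono[OF s(2), of "real N"] by (simp add: power2_eq_square)
    then have "s * N \<le> real_of_int (4 * int N ^ 2)"
      by simp
    then have hi: "\<lfloor>s * N\<rfloor> \<le> 4 * int N ^ 2"
      by linarith
    have "{k \<in> axis_indices N. real_of_int k / N * 1 \<le> s} = {- (4 * int N ^ 2)..\<lfloor>s * N\<rfloor>}"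
      using order_trans[OF _ hi] n0 by (auto simp: axis_indices_def le_floor_iff field_simps)
    then show ?thesis
      using lo by (simp add: axis_count_def)
  qed
  \<comment> \<open>The index set is symmetric, so the direction of the axis is irrelevant.\<close>
  have "u = 1 \<or> u = - 1" using u by linarith
  then have eq: "axis_count N u s = axis_count N 1 s" for s
  proof
    assume "u = - 1"
    then have "bij_betw uminus {k \<in> axis_indices N. real_of_int k / N * u \<le> s}
        {k \<in> axis_indices N. real_of_int k / N * 1 \<le> s}"
      by (intro bij_betwI[where g = uminus]) (auto simp: axis_indices_def)
    then show ?thesis
      unfolding axis_count_def by (rule bij_betw_same_card)
  qed simp
  have "real_of_int (int (axis_count N 1 t)) + (h * N - 1) \<le> real_of_int (int (axis_count N 1 (t + h)))"
    using one[of t] one[of "t + h"] t h by (simp add: algebra_simps) linarith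
  then show ?thesis by (simp add: eq)
qed

text \<open>
  The number of cell and background points together in the half-plane \<open>x u + y v \<le> t\<close>.
\<close>

definition total_count :: "nat \<Rightarrow> (nat \<times> nat \<Rightarrow> bool) \<Rightarrow> real \<Rightarrow> real \<Rightarrow> real \<Rightarrow> nat" where
  "total_count N \<rho> u v t = cell_count N \<rho> u v t + axis_count N u t + axis_count N v t"

text \<open>
  If the larger coordinate of \<open>(u, v)\<close> has modulus one, then on one of the two axes the background points project
  with gaps of exactly \<open>1 / N\<close>. Raising the level by \<open>\<delta>\<close> picks up at least \<open>\<delta> N - 1 \<ge> D\<close> of them,
  enough to outweigh the deficit \<open>D\<close> in cell points. For levels at which the half-plane contains no cell point or all
  of them there is nothing to compensate.
\<close>

lemma total_count_interlace_normalised: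
  assumes N: "N > 0"
    and net: "\<And>j k z. (j, k, z) \<in> halfplane_net N \<Longrightarrow>
      real (cell_count N \<rho> j k z) \<le> real (cell_count N \<rho>' j k z) + D"
    and \<delta>: "D + 1 \<le> \<delta> * N" "3 / N \<le> \<delta>"
    and uv: "max \<bar>u\<bar> \<bar>v\<bar> = 1"
  shows "total_count N \<rho> u v t \<le> total_count N \<rho>' u v (t + \<delta>)"
proof -
  have n0: "real N > 0" using N by simp
  have \<delta>0: "0 \<le> \<delta>" using \<delta>(2) n0 by (meson divide_nonneg_pos order_trans zero_le_numeral)
  have u: "\<bar>u\<bar> \<le> 1" and v: "\<bar>v\<bar> \<le> 1" using uv by (auto simp: max_def split: if_splits)
  have range: "\<bar>cell_height s u v c\<bar> \<le> 2 * N" if "c \<in> cells N" for s c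
  proof -
    have "fst c + 1 \<le> N" "snd c + 1 \<le> N"
      using that by (auto simp: cells_def)
    then have "real (fst c) + 1 \<le> N" "real (snd c) + 1 \<le> N"
      by linarith+
    then have "\<bar>real (fst c) + (if s then 0 else 1 / 2)\<bar> \<le> N" "\<bar>real (snd c)\<bar> \<le> N"
      by auto
    then have "\<bar>real (fst c) + (if s then 0 else 1 / 2)\<bar> * \<bar>u\<bar> \<le> N" "\<bar>real (snd c)\<bar> * \<bar>v\<bar> \<le> N"
      using u v by (metis mult_mono mult_1_right abs_ge_zero of_nat_0_le_iff)+
    then show ?thesis
      unfolding cell_height_def abs_mult[symmetric] by linarith
  qed
  have mono: "axis_count N u t \<le> axis_count N u (t + \<delta>)" "axis_count N v t \<le> axis_count N v (t + \<delta>)"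
    using \<delta>0 by (auto intro: axis_count_mono)
  consider "t < - 2 * real N" | "2 * N < t + \<delta>" | "- 2 * real N \<le> t" "t + \<delta> \<le> 2 * N"
    by linarith
  then show ?thesis
  proof cases
    case 1
    have "\<not> cell_height (\<rho> c) u v c \<le> t" if "c \<in> cells N" for c
      using range[OF that, of "\<rho> c"] 1 by linarith
    then have "{c \<in> cells N. cell_height (\<rho> c) u v c \<le> t} = {}"
      by blast
    then have "cell_count N \<rho> u v t = 0"
      by (simp add: cell_count_def)
    then show ?thesis
      using mono by (simp add: total_count_def)
  next
    case 2
    have "cell_height (\<rho>' c) u v c \<le> t + \<delta>" if "c \<in> cells N" for c
      using range[OF that, of "\<rho>' c"] 2 by linarith
    then have "{c \<in> cells N. cell_height (\<rho>' c) u v c \<le> t + \<delta>} = cells N"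
      by blast
    then have "cell_count N \<rho> u v t \<le> cell_count N \<rho>' u v (t + \<delta>)"
      by (simp add: cell_count_def card_mono)
    then show ?thesis
      using mono by (simp add: total_count_def)
  next
    case 3
    then have "\<bar>t\<bar> \<le> 2 * N"
      using \<delta>0 by linarith
    then have "real (cell_count N \<rho> u v t) \<le> real (cell_count N \<rho>' u v (t + 3 / N)) + D"
      by (intro cell_count_le_by_rounding N net u v)
    also have "cell_count N \<rho>' u v (t + 3 / N) \<le> cell_count N \<rho>' u v (t + \<delta>)"
      using \<delta> by (intro cell_count_mono) simp
    finally have cells: "real (cell_count N \<rho> u v t) \<le> real (cell_count N \<rho>' u v (t + \<delta>)) + D"
      by simp
    have axis: "real (axis_count N w t) + D \<le> real (axis_count N w (t + \<delta>))" if "\<bar>w\<bar> = 1" for w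
      using axis_count_growth[OF N that, of t \<delta>] 3 \<delta>(1) \<delta>0 n0 by simp
    have "\<bar>u\<bar> = 1 \<or> \<bar>v\<bar> = 1"
      using uv by (auto simp: max_def split: if_splits)
    then have "real (total_count N \<rho> u v t) \<le> real (total_count N \<rho>' u v (t + \<delta>))"
      using cells axis[of u] axis[of v] mono unfolding total_count_def by auto
    then show ?thesis by simp
  qed
qed

lemma total_count_scale:
  assumes "r > 0"
  shows "total_count N \<rho> (r * u) (r * v) (r * t) = total_count N \<rho> u v t"
proof -
  have "cell_height s (r * u) (r * v) c = r * cell_height s u v c" for s c
    by (simp add: cell_height_def algebra_simps)
  moreover have "k / N * (r * w) = r * (k / N * w)" for k w :: real
    by simp
  ultimately show ?thesis
    using assms unfolding total_count_def cell_count_def axis_count_def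
    by (simp only: mult_le_cancel_left_pos)
qed

text \<open>
  Directions of smaller norm also have to be covered, since \<open>e\<close> and \<open>f\<close> span only a plane, onto which a unit
  vector may project to any vector of norm at most one. Shrinking the direction shrinks the required shift
  along with it.
\<close>

lemma total_count_interlace:
  assumes N: "N > 0"
    and net: "\<And>j k z. (j, k, z) \<in> halfplane_net N \<Longrightarrow>
      real (cell_count N \<rho> j k z) \<le> real (cell_count N \<rho>' j k z) + D"
    and \<delta>: "D + 1 \<le> \<delta> * N" "3 / N \<le> \<delta>"
    and u: "\<bar>u\<bar> \<le> 1" and v: "\<bar>v\<bar> \<le> 1"
  shows "total_count N \<rho> u v t \<le> total_count N \<rho>' u v (t + \<delta>)"
proof -
  define r where "r = max \<bar>u\<bar> \<bar>v\<bar>"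
  have n0: "real N > 0" using N by simp
  have \<delta>0: "0 \<le> \<delta>" using \<delta>(2) n0 by (meson divide_nonneg_pos order_trans zero_le_numeral)
  have mono: "total_count N \<rho>' u v s \<le> total_count N \<rho>' u v s'" if "s \<le> s'" for s s'
    using that unfolding total_count_def by (intro add_mono cell_count_mono axis_count_mono)
  show ?thesis
  proof (cases "r = 0")
    case True
    then have "u = 0" "v = 0" by (auto simp: r_def max_def split: if_splits)
    then have "total_count N \<rho> u v t = total_count N \<rho>' u v t"
      by (simp add: total_count_def cell_count_def cell_height_def)
    then show ?thesis using mono[of t "t + \<delta>"] \<delta>0 by simp
  next
    case False
    then have r: "0 < r" "r \<le> 1" using u v by (auto simp: r_def)
    have uv: "u = r * (u / r)" "v = r * (v / r)" "t = r * (t / r)" using r by auto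
    have m: "max \<bar>u / r\<bar> \<bar>v / r\<bar> = 1"
      using r max_divide_distrib_right[of "\<bar>u\<bar>" "\<bar>v\<bar>" r] by (simp add: r_def[symmetric])
    have "total_count N \<rho> u v t = total_count N \<rho> (u / r) (v / r) (t / r)"
      using total_count_scale[OF r(1), of N \<rho> "u / r" "v / r" "t / r"] r by simp
    also have "\<dots> \<le> total_count N \<rho>' (u / r) (v / r) (t / r + \<delta>)"
      by (rule total_count_interlace_normalised[OF N _ \<delta> m]) (rule net)
    also have "\<dots> = total_count N \<rho>' u v (t + r * \<delta>)"
      using total_count_scale[OF r(1), of N \<rho>' "u / r" "v / r" "t / r + \<delta>"] r
      by (simp add: distrib_left)
    also have "\<dots> \<le> total_count N \<rho>' u v (t + \<delta>)"
      using r \<delta>0 by (intro mono) (simp add: mult_left_le_one_le)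
    finally show ?thesis .
  qed
qed

text \<open>
  With \<open>l\<close> of order \<open>\<delta>\<close>, the discrepancy is at most \<open>O(ln N / l) + l N\<close>, which is below \<open>\<delta> N - 1\<close> for large \<open>N\<close>.
\<close>

proposition exists_interlacing_signs:
  assumes "\<delta> > 0"
  shows "\<exists>N>0. \<exists>\<sigma>. \<forall>u v t. \<bar>u\<bar> \<le> 1 \<and> \<bar>v\<bar> \<le> 1 \<longrightarrow>
    total_count N \<sigma> u v t \<le> total_count N (\<lambda>c. \<not> \<sigma> c) u v (t + \<delta>) \<and>
    total_count N (\<lambda>c. \<not> \<sigma> c) u v t \<le> total_count N \<sigma> u v (t + \<delta>)"
proof -
  define l where "l = min 1 (\<delta> / 2)"
  have l: "0 < l" "l \<le> 1" "2 * l \<le> \<delta>" using assms by (auto simp: l_def)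
  have "eventually (\<lambda>N::nat. ln (90 * real N ^ 7) / l + l * N + 1 \<le> 2 * l * N) at_top"
    using l(1) by real_asymp
  moreover have "eventually (\<lambda>N::nat. 3 / N \<le> 2 * l) at_top"
    using l(1) by real_asymp
  ultimately have "eventually (\<lambda>N::nat. ln (90 * real N ^ 7) / l + l * N + 1 \<le> 2 * l * N \<and>
      3 / N \<le> 2 * l \<and> N > 0) at_top"
    using eventually_gt_at_top[of 0] by eventually_elim auto
  then obtain N :: nat where N: "N > 0" and N1: "ln (90 * real N ^ 7) / l + l * N + 1 \<le> 2 * l * N"
    and N2: "3 / N \<le> 2 * l"
    using eventually_happens'[OF sequentially_bot] by blast
  define D where "D = ln (90 * real N ^ 7) / l + l * N"
  have D: "D + 1 \<le> \<delta> * N" "3 / N \<le> \<delta>"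
    using N1 N2 l(3) mult_right_mono[OF l(3), of "real N"] unfolding D_def by auto
  obtain \<sigma> where \<sigma>: "\<And>j k z. (j, k, z) \<in> halfplane_net N \<Longrightarrow>
      \<bar>real (cell_count N \<sigma> j k z) - real (cell_count N (\<lambda>c. \<not> \<sigma> c) j k z)\<bar> \<le> D"
    using exists_signs_balancing_halfplane_net[OF N l(1,2)] unfolding D_def by blast
  have "total_count N \<sigma> u v t \<le> total_count N (\<lambda>c. \<not> \<sigma> c) u v (t + \<delta>) \<and>
      total_count N (\<lambda>c. \<not> \<sigma> c) u v t \<le> total_count N \<sigma> u v (t + \<delta>)"
    if "\<bar>u\<bar> \<le> 1 \<and> \<bar>v\<bar> \<le> 1" for u v t
  proof (intro conjI total_count_interlace[OF N _ D])
    fix j k z assume "(j, k, z) \<in> halfplane_net N"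
    from \<sigma>[OF this]
    show "real (cell_count N \<sigma> j k z) \<le> real (cell_count N (\<lambda>c. \<not> \<sigma> c) j k z) + D"
      "real (cell_count N (\<lambda>c. \<not> \<sigma> c) j k z) \<le> real (cell_count N \<sigma> j k z) + D"
      by linarith+
  qed (use that in auto)
  then show ?thesis using N by blast
qed

section \<open>Bounds for Wasserstein distances\<close>

lemma ennreal_powr_mono:
  assumes "0 < a" and "x \<le> y"
  shows "ennreal_powr x a \<le> ennreal_powr y a"
  using assms by (cases x; cases y) (auto simp: ennreal_powr_def powr_mono2 top_unique)

lemma ennreal_powr_ennreal:
  assumes "0 \<le> x"
  shows "ennreal_powr (ennreal x) a = ennreal (x powr a)"
  using assms by (simp add: ennreal_powr_def)

lemma ennreal_powr_powr_inverse:
  assumes "0 \<le> x" and "a \<noteq> 0"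
  shows "ennreal_powr (ennreal (x powr a)) (1 / a) = ennreal x"
  using assms by (cases "x = 0") (simp_all add: ennreal_powr_ennreal powr_powr ennreal_powr_def)

lemma one_le_enn2real:
  assumes "1 \<le> p" and "p \<noteq> \<infinity>"
  shows "1 \<le> enn2real p"
  using assms by (cases p) auto

lemma borel_measurable_fst_snd:
  "fst \<in> borel_measurable (borel :: ('a::second_countable_topology \<times> 'b::second_countable_topology) measure)"
  "snd \<in> borel_measurable (borel :: ('a::second_countable_topology \<times> 'b::second_countable_topology) measure)"
  by (rule borel_measurable_continuous_onI, rule continuous_on_fst continuous_on_snd, rule continuous_on_id)+

lemma measurable_coupling:
  assumes "\<gamma> \<in> couplings \<mu> \<nu>"
  shows "fst \<in> borel_measurable \<gamma>" and "snd \<in> borel_measurable \<gamma>"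
  using assms borel_measurable_fst_snd by (auto simp: couplings_def cong: measurable_cong_sets)

lemma measurable_dist_coupling:
  fixes \<mu> \<nu> :: "'a::{metric_space, second_countable_topology} measure"
  assumes "\<gamma> \<in> couplings \<mu> \<nu>"
  shows "(\<lambda>z. dist (fst z) (snd z)) \<in> borel_measurable \<gamma>"
  by (intro borel_measurable_dist measurable_coupling[OF assms])

lemma prob_space_coupling:
  assumes "\<gamma> \<in> couplings \<mu> \<nu>" and "prob_space \<mu>"
  shows "prob_space \<gamma>"
proof (rule prob_space_distrD)
  show "fst \<in> borel_measurable \<gamma>"
    using assms(1) by (rule measurable_coupling)
  show "prob_space (distr \<gamma> borel fst)"
    using assms by (simp add: couplings_def)
qed

text \<open>
  Lower bounds on the \<open>W\<^sub>1\<close>-cost of couplings pass to all exponents. For finite exponents \<open>P\<close> this is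
  Jensen's inequality, proved here by integrating its tangent line at \<open>\<kappa>\<close>: by Young's inequality
  \<open>d \<le> (\<kappa> powr (1 - P) / P) * d powr P + (1 - 1 / P) * \<kappa>\<close> for all \<open>d \<ge> 0\<close>.
\<close>

lemma le_wasserstein:
  fixes \<mu> \<nu> :: "'a::{metric_space, second_countable_topology} measure"
  assumes p: "1 \<le> p" and \<mu>: "prob_space \<mu>" and \<kappa>: "0 < \<kappa>"
    and cost: "\<And>\<gamma>. \<gamma> \<in> couplings \<mu> \<nu> \<Longrightarrow> ennreal \<kappa> \<le> (\<integral>\<^sup>+ z. ennreal (dist (fst z) (snd z)) \<partial>\<gamma>)"
  shows "ennreal \<kappa> \<le> wasserstein p \<mu> \<nu>"
proof (cases "p = \<infinity>")
  case True
  have "ennreal \<kappa> \<le> esssup \<gamma> (\<lambda>(x, y). ennreal (dist x y))" if \<gamma>: "\<gamma> \<in> couplings \<mu> \<nu>" for \<gamma>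
  proof -
    interpret prob_space \<gamma> using prob_space_coupling[OF \<gamma> \<mu>] .
    have "AE z in \<gamma>. ennreal (dist (fst z) (snd z)) \<le> esssup \<gamma> (\<lambda>(x, y). ennreal (dist x y))"
      using esssup_AE[of "\<lambda>(x, y). ennreal (dist x y)" \<gamma>] by (simp add: case_prod_unfold)
    then have "(\<integral>\<^sup>+ z. ennreal (dist (fst z) (snd z)) \<partial>\<gamma>)
        \<le> (\<integral>\<^sup>+ z. esssup \<gamma> (\<lambda>(x, y). ennreal (dist x y)) \<partial>\<gamma>)"
      by (rule nn_integral_mono_AE)
    also have "\<dots> = esssup \<gamma> (\<lambda>(x, y). ennreal (dist x y))"
      by (simp add: emeasure_space_1)
    finally show ?thesis
      using cost[OF \<gamma>] by (rule order_trans[rotated])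
  qed
  then show ?thesis
    using True by (auto simp: wasserstein_def intro!: INF_greatest)
next
  case False
  define P where "P = enn2real p"
  have P: "1 \<le> P"
    using one_le_enn2real[OF p False] by (simp add: P_def)
  \<comment> \<open>Weights \<open>1 / P\<close> and \<open>1 - 1 / P\<close> applied to \<open>\<kappa> powr (1 - P) * d powr P\<close> and \<open>\<kappa>\<close>, whose weighted geometric mean is \<open>d\<close>.\<close>
  have young: "d \<le> (\<kappa> powr (1 - P) / P) * d powr P + (1 - 1 / P) * \<kappa>" if d: "0 \<le> d" for d
  proof (cases "d = 0")
    case True
    then show ?thesis using P \<kappa> by simp
  next
    case False
    have "(\<kappa> powr (1 - P) * d powr P) powr (1 / P) * \<kappa> powr (1 - 1 / P)
        \<le> 1 / P * (\<kappa> powr (1 - P) * d powr P) + (1 - 1 / P) * \<kappa>"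
      using P \<kappa> d False by (intro Youngs_inequality_0) auto
    moreover have "(\<kappa> powr (1 - P) * d powr P) powr (1 / P) * \<kappa> powr (1 - 1 / P) = d"
    proof -
      have "(\<kappa> powr (1 - P) * d powr P) powr (1 / P) = \<kappa> powr (1 / P - 1) * d"
        using P \<kappa> d by (simp add: powr_mult powr_powr diff_divide_distrib)
      then show ?thesis
        using \<kappa> by (simp add: powr_add[symmetric] mult.commute mult.left_commute)
    qed
    ultimately show ?thesis by simp
  qed
  have "ennreal (\<kappa> powr P) \<le> (\<integral>\<^sup>+ (x, y). ennreal (dist x y powr P) \<partial>\<gamma>)"
    if \<gamma>: "\<gamma> \<in> couplings \<mu> \<nu>" for \<gamma>
  proof (cases "\<integral>\<^sup>+ (x, y). ennreal (dist x y powr P) \<partial>\<gamma>")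
    case (real A)
    interpret prob_space \<gamma> using prob_space_coupling[OF \<gamma> \<mu>] .
    note measurable_dist_coupling[OF \<gamma>, measurable]
    define B where "B = \<kappa> powr (1 - P) / P"
    have B: "0 \<le> B" using P by (simp add: B_def)
    have "ennreal \<kappa> \<le> (\<integral>\<^sup>+ z. ennreal (dist (fst z) (snd z)) \<partial>\<gamma>)"
      by (rule cost[OF \<gamma>])
    also have "\<dots> \<le> (\<integral>\<^sup>+ z. (ennreal B * ennreal (dist (fst z) (snd z) powr P)
        + ennreal ((1 - 1 / P) * \<kappa>)) \<partial>\<gamma>)"
      using young B P \<kappa>
      by (intro nn_integral_mono) (simp add: B_def ennreal_mult'[symmetric] ennreal_plus[symmetric] del: ennreal_plus)
    also have "\<dots> = ennreal B * (\<integral>\<^sup>+ z. ennreal (dist (fst z) (snd z) powr P) \<partial>\<gamma>) + ennreal ((1 - 1 / P) * \<kappa>)"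
      by (simp add: nn_integral_add nn_integral_cmult emeasure_space_1)
    also have "(\<integral>\<^sup>+ z. ennreal (dist (fst z) (snd z) powr P) \<partial>\<gamma>) = ennreal A"
      using real(2) by (simp add: case_prod_unfold)
    also have "ennreal B * ennreal A + ennreal ((1 - 1 / P) * \<kappa>) = ennreal (B * A + (1 - 1 / P) * \<kappa>)"
      using B real(1) P \<kappa> by (simp add: ennreal_mult' ennreal_plus)
    finally have "\<kappa> \<le> B * A + (1 - 1 / P) * \<kappa>"
      using B real(1) P \<kappa> by (subst (asm) ennreal_le_iff) auto
    then have "\<kappa> / P \<le> \<kappa> powr (1 - P) * A / P"
      by (simp add: B_def algebra_simps)
    then have "\<kappa> \<le> \<kappa> powr (1 - P) * A"
      using P by (simp add: divide_le_cancel)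
    then have "\<kappa> * \<kappa> powr (P - 1) \<le> (\<kappa> powr (1 - P) * A) * \<kappa> powr (P - 1)"
      by (rule mult_right_mono) simp
    also have "(\<kappa> powr (1 - P) * A) * \<kappa> powr (P - 1) = A * (\<kappa> powr (1 - P) * \<kappa> powr (P - 1))"
      by simp
    also have "\<kappa> powr (1 - P) * \<kappa> powr (P - 1) = 1"
      using \<kappa> by (simp add: powr_add[symmetric])
    also have "\<kappa> * \<kappa> powr (P - 1) = \<kappa> powr P"
      using \<kappa> by (simp add: powr_mult_base)
    finally show ?thesis
      using real by (simp add: ennreal_leI)
  qed simp
  then have "ennreal (\<kappa> powr P)
      \<le> (INF \<gamma> \<in> couplings \<mu> \<nu>. \<integral>\<^sup>+ (x, y). ennreal (dist x y powr P) \<partial>\<gamma>)"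
    by (rule INF_greatest)
  then have "ennreal_powr (ennreal (\<kappa> powr P)) (1 / P)
      \<le> ennreal_powr (INF \<gamma> \<in> couplings \<mu> \<nu>. \<integral>\<^sup>+ (x, y). ennreal (dist x y powr P) \<partial>\<gamma>) (1 / P)"
    using P by (intro ennreal_powr_mono) auto
  then show ?thesis
    using P \<kappa> False by (simp add: ennreal_powr_powr_inverse wasserstein_def P_def)
qed

lemma wasserstein_le_of_coupling:
  fixes \<mu> \<nu> :: "'a::{metric_space, second_countable_topology} measure"
  assumes p: "1 \<le> p" and \<mu>: "prob_space \<mu>" and \<delta>: "0 \<le> \<delta>"
    and \<gamma>: "\<gamma> \<in> couplings \<mu> \<nu>" and close: "AE z in \<gamma>. dist (fst z) (snd z) \<le> \<delta>"
  shows "wasserstein p \<mu> \<nu> \<le> ennreal \<delta>"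
proof -
  interpret prob_space \<gamma> using prob_space_coupling[OF \<gamma> \<mu>] .
  note measurable_dist_coupling[OF \<gamma>, measurable]
  show ?thesis
  proof (cases "p = \<infinity>")
    case True
    have "esssup \<gamma> (\<lambda>(x, y). ennreal (dist x y)) \<le> ennreal \<delta>"
      unfolding case_prod_unfold
    proof (rule esssup_I)
      show "AE z in \<gamma>. ennreal (dist (fst z) (snd z)) \<le> ennreal \<delta>"
        using close by eventually_elim (rule ennreal_leI)
    qed measurable
    then show ?thesis
      using True \<gamma> by (auto simp: wasserstein_def intro: INF_lower2)
  next
    case False
    define P where "P = enn2real p"
    have P: "1 \<le> P"
      using one_le_enn2real[OF p False] by (simp add: P_def)
    have "(INF \<gamma> \<in> couplings \<mu> \<nu>. \<integral>\<^sup>+ (x, y). ennreal (dist x y powr P) \<partial>\<gamma>)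
        \<le> (\<integral>\<^sup>+ (x, y). ennreal (dist x y powr P) \<partial>\<gamma>)"
      using \<gamma> by (rule INF_lower)
    also have "\<dots> \<le> (\<integral>\<^sup>+ z. ennreal (\<delta> powr P) \<partial>\<gamma>)"
      unfolding case_prod_unfold
      by (rule nn_integral_mono_AE, use close in eventually_elim)
        (use P in \<open>auto intro!: ennreal_leI powr_mono2\<close>)
    also have "\<dots> = ennreal (\<delta> powr P)"
      by (simp add: emeasure_space_1)
    finally have "ennreal_powr (INF \<gamma> \<in> couplings \<mu> \<nu>. \<integral>\<^sup>+ (x, y). ennreal (dist x y powr P) \<partial>\<gamma>) (1 / P)
        \<le> ennreal_powr (ennreal (\<delta> powr P)) (1 / P)"
      using P by (intro ennreal_powr_mono) auto
    then show ?thesis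
      using P \<delta> False by (simp add: ennreal_powr_powr_inverse wasserstein_def P_def)
  qed
qed

text \<open>
  The coupling is the monotone one: push forward Lebesgue measure on the unit interval by the pair of
  quantile functions. If \<open>w \<le> cdf M x\<close>, then \<open>w \<le> cdf N (x + \<delta>)\<close>, so the \<open>w\<close>-quantile of \<open>N\<close>
  exceeds that of \<open>M\<close> by at most \<open>\<delta>\<close>, and vice versa.
\<close>

lemma wasserstein_le_of_cdf_interlace:
  fixes M N :: "real measure"
  assumes p: "1 \<le> p" and \<delta>: "0 \<le> \<delta>"
    and M: "real_distribution M" and N: "real_distribution N"
    and MN: "\<And>t. cdf M t \<le> cdf N (t + \<delta>)" and NM: "\<And>t. cdf N t \<le> cdf M (t + \<delta>)"
  shows "wasserstein p M N \<le> ennreal \<delta>"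
proof -
  interpret M: cdf_distribution M using M by (simp add: cdf_distribution_def)
  interpret N: cdf_distribution N using N by (simp add: cdf_distribution_def)
  define \<Omega> where "\<Omega> = restrict_space lborel {0<..<1::real}"
  have sets\<Omega>: "sets \<Omega> = sets (restrict_space borel {0<..<1::real})"
    by (simp add: \<Omega>_def sets_restrict_space)
  have [measurable]: "M.I \<in> borel_measurable \<Omega>" "N.I \<in> borel_measurable \<Omega>"
    using M.measurable_CI N.measurable_CI by (simp_all add: measurable_cong_sets[OF sets\<Omega> refl])
  have pair [measurable]: "(\<lambda>w. (M.I w, N.I w)) \<in> borel_measurable \<Omega>"
    by (intro borel_measurable_Pair) measurable
  define \<gamma> where "\<gamma> = distr \<Omega> borel (\<lambda>w. (M.I w, N.I w))"
  have "\<gamma> \<in> couplings M N"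
    using M.distr_I_eq_M N.distr_I_eq_M pair
    by (simp add: couplings_def \<gamma>_def distr_distr[OF borel_measurable_fst_snd(1)]
        distr_distr[OF borel_measurable_fst_snd(2)] comp_def \<Omega>_def)
  moreover have "AE z in \<gamma>. dist (fst z) (snd z) \<le> \<delta>"
  proof -
    have "dist (M.I w) (N.I w) \<le> \<delta>" if w: "w \<in> space \<Omega>" for w
    proof -
      have w: "0 < w" "w < 1"
        using w by (auto simp: \<Omega>_def space_restrict_space)
      have "w \<le> cdf M (M.I w)" and "w \<le> cdf N (N.I w)"
        by (rule iffD2[OF M.pseudoinverse[OF w] order_refl],
            rule iffD2[OF N.pseudoinverse[OF w] order_refl])
      then have "w \<le> cdf N (M.I w + \<delta>)" and "w \<le> cdf M (N.I w + \<delta>)"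
        using MN[of "M.I w"] NM[of "N.I w"] by linarith+
      note iffD1[OF N.pseudoinverse[OF w] this(1)] iffD1[OF M.pseudoinverse[OF w] this(2)]
      then show ?thesis
        by (simp add: dist_real_def abs_le_iff)
    qed
    moreover have "{z :: real \<times> real. dist (fst z) (snd z) \<le> \<delta>} \<in> sets borel"
      by (intro borel_closed closed_Collect_le continuous_intros)
    ultimately show ?thesis
      unfolding \<gamma>_def by (subst AE_distr_iff[OF pair]) auto
  qed
  ultimately show ?thesis
    using wasserstein_le_of_coupling[OF p M.prob_space_axioms \<delta>] by blast
qed

text \<open>
  Averaging a constant cannot increase it, whatever the Hausdorff measure of the sphere: if that measure is zero or infinite,
  the quotient in the definition of the sliced distance is zero by the conventions for division in the extended nonnegative reals.
\<close>

lemma sliced_wasserstein_le: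
  assumes q: "1 \<le> q" and \<delta>: "0 \<le> \<delta>"
    and slices: "\<And>\<theta>. norm \<theta> = 1 \<Longrightarrow> wasserstein p (slice \<theta> \<mu>) (slice \<theta> \<nu>) \<le> ennreal \<delta>"
  shows "sliced_wasserstein p q \<mu> \<nu> \<le> ennreal \<delta>"
proof (cases "q = \<infinity>")
  case True
  then show ?thesis
    using slices by (auto simp: sliced_wasserstein_def intro!: SUP_least)
next
  case False
  define Q where "Q = enn2real q"
  have Q: "1 \<le> Q"
    using one_le_enn2real[OF q False] by (simp add: Q_def)
  define H where "H = (hausdorff_measure (DIM('a) - 1) :: 'a measure)"
  define S where "S = (sphere 0 1 :: 'a set)"
  have S: "S \<in> sets H"
    by (simp add: S_def H_def)
  have "(\<integral>\<^sup>+ \<theta> \<in> S. ennreal_powr (wasserstein p (slice \<theta> \<mu>) (slice \<theta> \<nu>)) Q \<partial>H)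
      \<le> (\<integral>\<^sup>+ \<theta> \<in> S. ennreal (\<delta> powr Q) \<partial>H)"
  proof (intro nn_integral_mono)
    fix \<theta>
    show "ennreal_powr (wasserstein p (slice \<theta> \<mu>) (slice \<theta> \<nu>)) Q * indicator S \<theta>
        \<le> ennreal (\<delta> powr Q) * indicator S \<theta>"
      using ennreal_powr_mono[OF _ slices[of \<theta>], of Q] Q \<delta>
      by (auto simp: S_def indicator_def ennreal_powr_ennreal)
  qed
  also have "\<dots> = ennreal (\<delta> powr Q) * emeasure H S"
    using S by (rule nn_integral_cmult_indicator)
  finally have "(\<integral>\<^sup>+ \<theta> \<in> S. ennreal_powr (wasserstein p (slice \<theta> \<mu>) (slice \<theta> \<nu>)) Q \<partial>H) / emeasure H S
      \<le> ennreal (\<delta> powr Q) * emeasure H S / emeasure H S"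
    by (rule divide_right_mono_ennreal)
  also have "\<dots> \<le> ennreal (\<delta> powr Q)"
  proof (cases "emeasure H S = 0 \<or> emeasure H S = \<infinity>")
    case True
    then show ?thesis by auto
  next
    case False
    then show ?thesis by (simp add: ennreal_mult_divide_eq)
  qed
  finally have "ennreal_powr ((\<integral>\<^sup>+ \<theta> \<in> S. ennreal_powr (wasserstein p (slice \<theta> \<mu>) (slice \<theta> \<nu>)) Q \<partial>H)
      / emeasure H S) (1 / Q) \<le> ennreal_powr (ennreal (\<delta> powr Q)) (1 / Q)"
    using Q by (intro ennreal_powr_mono) auto
  then show ?thesis
    using Q \<delta> False by (simp add: ennreal_powr_powr_inverse sliced_wasserstein_def Q_def H_def S_def)
qed

section \<open>Empirical measures\<close>

definition empirical :: "'j set \<Rightarrow> ('j \<Rightarrow> 'a::topological_space) \<Rightarrow> 'a measure" where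
  "empirical J X = distr (measure_pmf (pmf_of_set J)) borel X"

lemma sets_empirical [simp]: "sets (empirical J X) = sets borel"
  by (simp add: empirical_def)

lemma prob_space_empirical: "prob_space (empirical J X)"
  unfolding empirical_def by (intro measure_pmf.prob_space_distr) simp

lemma nn_integral_empirical:
  assumes "finite J" "J \<noteq> {}" and "f \<in> borel_measurable borel"
  shows "(\<integral>\<^sup>+ x. f x \<partial>empirical J X) = (\<Sum>j\<in>J. f (X j)) / card J"
  using assms by (simp add: empirical_def nn_integral_distr nn_integral_pmf_of_set)

lemma slice_empirical: "slice \<theta> (empirical J X) = empirical J (\<lambda>j. X j \<bullet> \<theta>)"
  unfolding slice_def empirical_def by (subst distr_distr) (auto simp: comp_def)

lemma cdf_empirical:
  assumes "finite J" "J \<noteq> {}"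
  shows "cdf (empirical J x) t = card {j \<in> J. x j \<le> t} / card J"
proof -
  have "J \<inter> x -` {..t} = {j \<in> J. x j \<le> t}" by auto
  then show ?thesis
    using assms by (simp add: cdf_def empirical_def measure_distr measure_pmf_of_set)
qed

lemma empirical_in_wspace:
  fixes X :: "'j \<Rightarrow> 'a::euclidean_space"
  assumes J: "finite J" "J \<noteq> {}"
  shows "empirical J X \<in> wspace p"
proof -
  have "measure_support (empirical J X) \<subseteq> X ` J"
  proof
    fix x assume x: "x \<in> measure_support (empirical J X)"
    show "x \<in> X ` J"
    proof (rule ccontr)
      assume "x \<notin> X ` J"
      have op: "open (- (X ` J))"
        using J by (intro open_Compl finite_imp_closed) simp
      have "J \<inter> X -` (- (X ` J)) = {}" by auto
      then have "emeasure (empirical J X) (- (X ` J)) = 0"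
        using J op by (simp add: empirical_def emeasure_distr emeasure_pmf_of_set)
      then show False
        using x op \<open>x \<notin> X ` J\<close> unfolding measure_support_def by fastforce
    qed
  qed
  then have "bounded (measure_support (empirical J X))"
    using J finite_imp_bounded bounded_subset by blast
  moreover have "(\<integral>\<^sup>+ x. ennreal (norm x powr enn2real p) \<partial>empirical J X) < \<infinity>"
    using J by (simp add: nn_integral_empirical ennreal_divide_eq_top_iff less_top[symmetric]
        of_nat_eq_0_iff[where 'a = ennreal])
  ultimately show ?thesis
    by (simp add: wspace_def prob_space_empirical)
qed

text \<open>
  The easy half of Kantorovich duality, with a 1-Lipschitz test function \<open>f\<close>.
\<close>

lemma wasserstein_empirical_ge:
  fixes X Y :: "'j \<Rightarrow> 'a::{metric_space, second_countable_topology}" and \<kappa> :: real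
  assumes p: "1 \<le> p" and J: "finite J" "J \<noteq> {}"
    and f: "f \<in> borel_measurable borel" "\<And>x. 0 \<le> f x" "\<And>x y. f y \<le> f x + dist x y"
    and \<kappa>: "0 < \<kappa>" "\<kappa> * card J \<le> (\<Sum>j\<in>J. f (Y j)) - (\<Sum>j\<in>J. f (X j))"
  shows "ennreal \<kappa> \<le> wasserstein p (empirical J X) (empirical J Y)"
proof (rule le_wasserstein[OF p prob_space_empirical \<kappa>(1)])
  fix \<gamma> assume \<gamma>: "\<gamma> \<in> couplings (empirical J X) (empirical J Y)"
  have fst: "distr \<gamma> borel fst = empirical J X"
    and snd: "distr \<gamma> borel snd = empirical J Y"
    using \<gamma> by (auto simp: couplings_def)
  note measurable_coupling[OF \<gamma>, measurable] measurable_dist_coupling[OF \<gamma>, measurable] f(1) [measurable]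
  have avg: "(\<integral>\<^sup>+ x. ennreal (f x) \<partial>empirical J Z) = ennreal ((\<Sum>j\<in>J. f (Z j)) / card J)" for Z
    using J f by (simp add: nn_integral_empirical sum_ennreal sum_nonneg ennreal_of_nat_eq_real_of_nat
        divide_ennreal card_gt_0_iff)
  define A B where "A = (\<Sum>j\<in>J. f (X j)) / card J" and "B = (\<Sum>j\<in>J. f (Y j)) / card J"
  have A: "0 \<le> A" using f by (simp add: A_def sum_nonneg)
  have card: "real (card J) > 0" using J by (simp add: card_gt_0_iff)
  have "ennreal B = (\<integral>\<^sup>+ z. ennreal (f (snd z)) \<partial>\<gamma>)"
    unfolding B_def avg[symmetric] snd[symmetric] by (subst nn_integral_distr) auto
  also have "\<dots> \<le> (\<integral>\<^sup>+ z. (ennreal (f (fst z)) + ennreal (dist (fst z) (snd z))) \<partial>\<gamma>)"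
    using f(2,3) by (intro nn_integral_mono) (simp add: ennreal_plus[symmetric] del: ennreal_plus)
  also have "\<dots> = (\<integral>\<^sup>+ z. ennreal (f (fst z)) \<partial>\<gamma>) + (\<integral>\<^sup>+ z. ennreal (dist (fst z) (snd z)) \<partial>\<gamma>)"
    by (rule nn_integral_add) auto
  also have "(\<integral>\<^sup>+ z. ennreal (f (fst z)) \<partial>\<gamma>) = ennreal A"
    unfolding A_def avg[symmetric] fst[symmetric] by (subst nn_integral_distr) auto
  finally have B: "ennreal B \<le> ennreal A + (\<integral>\<^sup>+ z. ennreal (dist (fst z) (snd z)) \<partial>\<gamma>)" .
  have "\<kappa> \<le> B - A"
    using \<kappa>(2) card unfolding A_def B_def diff_divide_distrib[symmetric] by (simp only: le_divide_eq if_True)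
  then have "A + \<kappa> \<le> B"
    by simp
  then have "ennreal A + ennreal \<kappa> \<le> ennreal B"
    using A \<kappa>(1) by (simp add: ennreal_plus[symmetric] ennreal_leI add.commute del: ennreal_plus)
  then have "ennreal A + ennreal \<kappa> \<le> ennreal A + (\<integral>\<^sup>+ z. ennreal (dist (fst z) (snd z)) \<partial>\<gamma>)"
    using B by (rule order_trans)
  then show "ennreal \<kappa> \<le> (\<integral>\<^sup>+ z. ennreal (dist (fst z) (snd z)) \<partial>\<gamma>)"
    by (simp add: ennreal_add_left_cancel_le)
qed

section \<open>The two configurations\<close>

definition config_indices :: "nat \<Rightarrow> ((nat \<times> nat) + (bool \<times> int)) set" where
  "config_indices N = cells N <+> (UNIV \<times> axis_indices N)"

text \<open>
  Left summands index the cells, right summands the background points. The sign function \<open>\<rho>\<close> selects a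
  point in each cell, so that \<open>\<rho>\<close> and its negation together use both points of every cell exactly once.
\<close>

definition config ::
    "nat \<Rightarrow> 'a \<Rightarrow> 'a \<Rightarrow> (nat \<times> nat \<Rightarrow> bool) \<Rightarrow> (nat \<times> nat) + (bool \<times> int) \<Rightarrow> 'a::real_vector" where
  "config N e f \<rho> = case_sum
    (\<lambda>c. (real (fst c) + (if \<rho> c then 0 else 1 / 2)) *\<^sub>R e + real (snd c) *\<^sub>R f)
    (\<lambda>(b, k). (real_of_int k / N) *\<^sub>R (if b then e else f))"

lemma finite_config_indices [simp]: "finite (config_indices N)"
  by (simp add: config_indices_def)

lemma card_config_indices_le:
  assumes "N > 0"
  shows "real (card (config_indices N)) \<le> 19 * real N ^ 2"
proof -
  have "int (card (config_indices N)) = int N ^ 2 + 2 * (8 * int N ^ 2 + 1)"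
    by (simp add: config_indices_def card_Plus card_cartesian_product cells_def axis_indices_def
        power2_eq_square)
  then have "real_of_int (int (card (config_indices N))) = real_of_int (17 * int N ^ 2 + 2)"
    by simp
  then have "real (card (config_indices N)) = 17 * real N ^ 2 + 2"
    by simp
  moreover have "1 \<le> real N ^ 2"
    using assms by simp
  ultimately show ?thesis by simp
qed

lemma config_indices_nonempty: "config_indices N \<noteq> {}"
proof -
  have "Inr (True, 0) \<in> config_indices N"
    unfolding config_indices_def by (rule InrI) (simp add: axis_indices_def)
  then show ?thesis by blast
qed

lemma card_config_below:
  fixes e f \<theta> :: "'a::real_inner"
  shows "card {j \<in> config_indices N. config N e f \<rho> j \<bullet> \<theta> \<le> t} = total_count N \<rho> (e \<bullet> \<theta>) (f \<bullet> \<theta>) t"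
proof -
  define C where "C = {c \<in> cells N. cell_height (\<rho> c) (e \<bullet> \<theta>) (f \<bullet> \<theta>) c \<le> t}"
  define A where "A u = {k \<in> axis_indices N. real_of_int k / N * u \<le> t}" for u
  have "{j \<in> config_indices N. config N e f \<rho> j \<bullet> \<theta> \<le> t}
      = C <+> (({True} \<times> A (e \<bullet> \<theta>)) \<union> ({False} \<times> A (f \<bullet> \<theta>)))"
    by (auto simp: config_indices_def config_def C_def A_def cell_height_def inner_add_left split: if_splits)
  also have "card \<dots> = card C + (card (A (e \<bullet> \<theta>)) + card (A (f \<bullet> \<theta>)))"
    by (subst card_Plus, simp add: C_def, simp add: A_def, subst card_Un_disjoint)
       (auto simp: A_def card_cartesian_product)
  finally show ?thesis
    by (simp add: total_count_def cell_count_def axis_count_def C_def A_def)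
qed

text \<open>
  In the basis \<open>e\<close>, \<open>f\<close> the cell points lie on the lattice \<open>(1/2)\<int> \<times> \<int>\<close>, so distinct ones are at distance at
  least \<open>1/2\<close>; and a point chosen by \<open>\<sigma>\<close> is never chosen by its negation.
\<close>

lemma half_le_dist_config:
  fixes e f :: "'a::euclidean_space"
  assumes ef: "e \<in> Basis" "f \<in> Basis" "e \<noteq> f"
  shows "1 / 2 \<le> dist (config N e f (\<lambda>c. \<not> \<sigma> c) (Inl c)) (config N e f \<sigma> (Inl c'))"
proof -
  define w where "w = config N e f (\<lambda>c. \<not> \<sigma> c) (Inl c) - config N e f \<sigma> (Inl c')"
  have we: "w \<bullet> e = (real (fst c) + (if \<sigma> c then 1 / 2 else 0)) - (real (fst c') + (if \<sigma> c' then 0 else 1 / 2))"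
    and wf: "w \<bullet> f = real (snd c) - real (snd c')"
    using ef by (simp_all add: w_def config_def inner_diff_left inner_add_left inner_Basis)
  have "1 / 2 \<le> \<bar>w \<bullet> e\<bar> \<or> 1 / 2 \<le> \<bar>w \<bullet> f\<bar>"
  proof (cases "snd c = snd c'")
    case False
    then have "1 \<le> \<bar>real (snd c) - real (snd c')\<bar>"
      by linarith
    then show ?thesis by (simp add: wf)
  next
    case True
    then have "fst c \<noteq> fst c' \<or> \<sigma> c = \<sigma> c'"
      by (metis prod.expand)
    then have "fst c + 1 \<le> fst c' \<or> fst c' + 1 \<le> fst c \<or> fst c = fst c' \<and> \<sigma> c = \<sigma> c'"
      by linarith
    then have "real (fst c) + 1 \<le> real (fst c') \<or> real (fst c') + 1 \<le> real (fst c) \<or>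
        fst c = fst c' \<and> \<sigma> c = \<sigma> c'"
      by linarith
    then have "1 / 2 \<le> \<bar>w \<bullet> e\<bar>"
      unfolding we by (auto split: if_splits)
    then show ?thesis ..
  qed
  then have "1 / 2 \<le> norm w"
    using Basis_le_norm[OF ef(1), of w] Basis_le_norm[OF ef(2), of w] by linarith
  then show ?thesis
    by (simp add: w_def dist_norm)
qed

text \<open>
  The test function is the distance to the cell points of the first configuration. It integrates to the same
  value over both backgrounds, vanishes on the first set of cell points, and is at least \<open>1/2\<close> on the second. The
  constant is \<open>(N\<^sup>2 / 2) / (19 N\<^sup>2)\<close>.
\<close>

lemma wasserstein_config_ge:
  fixes e f :: "'a::euclidean_space"
  assumes p: "1 \<le> p" and N: "N > 0" and ef: "e \<in> Basis" "f \<in> Basis" "e \<noteq> f"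
  shows "ennreal (1 / 38) \<le> wasserstein p (empirical (config_indices N) (config N e f \<sigma>))
    (empirical (config_indices N) (config N e f (\<lambda>c. \<not> \<sigma> c)))"
proof -
  define X Y where "X = config N e f \<sigma>" and "Y = config N e f (\<lambda>c. \<not> \<sigma> c)"
  define S where "S = (\<lambda>c. X (Inl c)) ` cells N"
  have "(0, 0) \<in> cells N"
    using N by (simp add: cells_def)
  then have S: "S \<noteq> {}"
    by (auto simp: S_def)
  have far: "1 / 2 \<le> infdist (Y (Inl c)) S" for c
    unfolding infdist_notempty[OF S]
  proof (rule cINF_greatest[OF S])
    fix x assume "x \<in> S"
    then obtain c' where "x = X (Inl c')"
      unfolding S_def by blast
    then show "1 / 2 \<le> dist (Y (Inl c)) x"
      using half_le_dist_config[OF ef] by (simp only: X_def Y_def)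
  qed
  have split: "(\<Sum>j\<in>config_indices N. infdist (Z j) S)
      = (\<Sum>c\<in>cells N. infdist (Z (Inl c)) S) + (\<Sum>b\<in>UNIV \<times> axis_indices N. infdist (Z (Inr b)) S)" for Z
    by (simp add: config_indices_def sum.Plus)
  have "Y (Inr b) = X (Inr b)" for b
    by (simp add: X_def Y_def config_def)
  moreover have "(\<Sum>c\<in>cells N. infdist (X (Inl c)) S) = 0"
    by (intro sum.neutral) (auto simp: S_def)
  ultimately have "(\<Sum>j\<in>config_indices N. infdist (Y j) S) - (\<Sum>j\<in>config_indices N. infdist (X j) S)
      = (\<Sum>c\<in>cells N. infdist (Y (Inl c)) S)"
    by (simp add: split)
  also have "\<dots> \<ge> (\<Sum>c\<in>cells N. 1 / 2)"
    using far by (intro sum_mono)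
  also have "(\<Sum>c\<in>cells N. 1 / 2) = real N ^ 2 / 2"
    by (simp add: cells_def card_cartesian_product power2_eq_square)
  finally have "1 / 38 * real (card (config_indices N))
      \<le> (\<Sum>j\<in>config_indices N. infdist (Y j) S) - (\<Sum>j\<in>config_indices N. infdist (X j) S)"
    using card_config_indices_le[OF N] by linarith
  moreover have "infdist y S \<le> infdist x S + dist x y" for x y
    using infdist_triangle[of y S x] by (simp add: dist_commute)
  ultimately show ?thesis
    unfolding X_def[symmetric] Y_def[symmetric]
    by (intro wasserstein_empirical_ge[OF p, where f = "\<lambda>x. infdist x S"] finite_config_indices
          config_indices_nonempty borel_measurable_continuous_onI continuous_intros)
       (simp_all add: infdist_nonneg)
qed

text \<open>
  By \<open>card_config_below\<close> the distribution functions of the slices are the half-plane counts divided by the common number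
  of points, so interlacing counts give interlacing distribution functions.
\<close>

lemma sliced_wasserstein_config_le:
  fixes e f :: "'a::euclidean_space"
  assumes p: "1 \<le> p" and q: "1 \<le> q" and \<delta>: "0 \<le> \<delta>" and ef: "e \<in> Basis" "f \<in> Basis"
    and count: "\<And>u v t. \<bar>u\<bar> \<le> 1 \<Longrightarrow> \<bar>v\<bar> \<le> 1 \<Longrightarrow> total_count N \<rho> u v t \<le> total_count N \<rho>' u v (t + \<delta>)"
      "\<And>u v t. \<bar>u\<bar> \<le> 1 \<Longrightarrow> \<bar>v\<bar> \<le> 1 \<Longrightarrow> total_count N \<rho>' u v t \<le> total_count N \<rho> u v (t + \<delta>)"
  shows "sliced_wasserstein p q (empirical (config_indices N) (config N e f \<rho>))
    (empirical (config_indices N) (config N e f \<rho>')) \<le> ennreal \<delta>"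
proof (rule sliced_wasserstein_le[OF q \<delta>])
  fix \<theta> :: 'a assume \<theta>: "norm \<theta> = 1"
  have uv: "\<bar>e \<bullet> \<theta>\<bar> \<le> 1" "\<bar>f \<bullet> \<theta>\<bar> \<le> 1"
    using Basis_le_norm[OF ef(1), of \<theta>] Basis_le_norm[OF ef(2), of \<theta>] \<theta> by (simp_all add: inner_commute)
  have distribution: "real_distribution (empirical J x)" for J :: "((nat \<times> nat) + (bool \<times> int)) set" and x
    by (intro real_distribution.intro real_distribution_axioms.intro prob_space_empirical) simp
  show "wasserstein p (slice \<theta> (empirical (config_indices N) (config N e f \<rho>)))
      (slice \<theta> (empirical (config_indices N) (config N e f \<rho>'))) \<le> ennreal \<delta>"
    unfolding slice_empirical
    by (intro wasserstein_le_of_cdf_interlace[OF p \<delta> distribution distribution])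
       (simp_all add: cdf_empirical config_indices_nonempty card_config_below divide_right_mono count[OF uv])
qed

text \<open>
  The constant \<open>\<delta>\<close> is chosen such that \<open>C \<delta> = 1/39\<close> is smaller than the lower bound \<open>1/38\<close> for the Wasserstein distance.
\<close>

theorem sliced_wasserstein_not_bi_lipschitz:
  assumes "2 \<le> DIM('a::euclidean_space)" and p: "1 \<le> p" and q: "1 \<le> q"
  shows "\<not> bi_lipschitz_equivalent (wspace p :: 'a measure set) (sliced_wasserstein p q) (wasserstein p)"
proof
  assume "bi_lipschitz_equivalent (wspace p :: 'a measure set) (sliced_wasserstein p q) (wasserstein p)"
  then obtain C :: real where C: "C \<ge> 1" and bound: "\<And>\<mu> \<nu> :: 'a measure. \<mu> \<in> wspace p \<Longrightarrow> \<nu> \<in> wspace p \<Longrightarrow>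
      wasserstein p \<mu> \<nu> \<le> ennreal C * sliced_wasserstein p q \<mu> \<nu>"
    unfolding bi_lipschitz_equivalent_def by blast
  obtain e f :: 'a where ef: "e \<in> Basis" "f \<in> Basis" "e \<noteq> f"
    using assms(1) by (metis card_le_Suc0_iff_eq finite_Basis not_less_eq_eq numeral_2_eq_2)
  define \<delta> where "\<delta> = 1 / (39 * C)"
  have \<delta>: "0 < \<delta>" using C by (simp add: \<delta>_def)
  obtain N \<sigma> where N: "N > 0" and \<sigma>: "\<And>u v t. \<bar>u\<bar> \<le> 1 \<Longrightarrow> \<bar>v\<bar> \<le> 1 \<Longrightarrow>
      total_count N \<sigma> u v t \<le> total_count N (\<lambda>c. \<not> \<sigma> c) u v (t + \<delta>) \<and>
      total_count N (\<lambda>c. \<not> \<sigma> c) u v t \<le> total_count N \<sigma> u v (t + \<delta>)"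
    using exists_interlacing_signs[OF \<delta>] by blast
  define \<mu> \<nu> where "\<mu> = empirical (config_indices N) (config N e f \<sigma>)"
    and "\<nu> = empirical (config_indices N) (config N e f (\<lambda>c. \<not> \<sigma> c))"
  have "sliced_wasserstein p q \<mu> \<nu> \<le> ennreal \<delta>"
    unfolding \<mu>_def \<nu>_def using \<sigma> \<delta> by (intro sliced_wasserstein_config_le[OF p q _ ef(1,2)]) auto
  moreover have "ennreal (1 / 38) \<le> wasserstein p \<mu> \<nu>"
    unfolding \<mu>_def \<nu>_def by (rule wasserstein_config_ge[OF p N ef])
  moreover have "wasserstein p \<mu> \<nu> \<le> ennreal C * sliced_wasserstein p q \<mu> \<nu>"
    by (intro bound) (simp_all add: \<mu>_def \<nu>_def empirical_in_wspace config_indices_nonempty)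
  ultimately have "ennreal (1 / 38) \<le> ennreal C * ennreal \<delta>"
    by (meson mult_left_mono order_trans zero_le)
  also have "\<dots> = ennreal (1 / 39)"
    using C by (simp add: \<delta>_def ennreal_mult'[symmetric])
  finally show False
    by (subst (asm) ennreal_le_iff) auto
qed

theorem theorem4p1:
  fixes p q :: ennreal
  assumes "CARD('n::finite) \<ge> 2"
    and "1 \<le> p" and "1 \<le> q"
    and "(CARD('n) = 2 \<and> q < \<infinity>)
       \<or> (CARD('n) = 2 \<and> p = 1 \<and> q = \<infinity>)
       \<or> CARD('n) \<ge> 3"
  shows "\<not> bi_lipschitz_equivalent (wspace p :: (real ^ 'n) measure set)
           (sliced_wasserstein p q) (wasserstein p)"
  by (rule sliced_wasserstein_not_bi_lipschitz) (use assms in auto)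

end
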